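(* Let $n$ be a positive integer and let $\mathbb{C}\mathbb{Z}_n$ be the regular representation of the dihedral quandle $\mathbb{Z}_n$. Its decomposition into irreducible subrepresentations of $\mathbb{Z}_n$ is as follows. If $n=4k$, then $$\mathbb{C}\mathbb{Z}_n\cong \mathbb{C}(1,1)^{\oplus 2}\oplus\mathbb{C}(1,-1)\oplus\mathbb{C}(-1,1)\oplus\bigoplus_{s=1}^{k-1}W(\omega_{2k}^s)^{\oplus 2}.$$ If $n=4k+2$, then $$\mathbb{C}\mathbb{Z}_n\cong \mathbb{C}(1,1)^{\oplus 2}\oplus\bigoplus_{s=1}^{k}W(\omega_{2k+1}^s)^{\oplus 2}.$$ If $n=2r+1$ is odd, then $$\mathbb{C}\mathbb{Z}_n\cong \mathbb{C}(1,1)\oplus\bigoplus_{s=1}^{r}W(\omega_n^{2s}).$$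
   Context: The dihedral quandle $\mathbb{Z}_n=\{1,\dots,n\}$ has operation $x\triangleright y=2y-x \pmod n$. A representation of a quandle $X$ on a finite-dimensional complex vector space $V$ is a map $\rho:X\to GL(V)$ with $\rho(x\triangleright y)=\rho(y)\rho(x)\rho(y)^{-1}$; a subrepresentation is a subspace invariant under all $\rho(x)$; it is irreducible if its only subrepresentations are $0$ and itself. The regular representation of $\mathbb{Z}_n$ is $\lambda:\mathbb{Z}_n\to GL(\mathbb{C}\mathbb{Z}_n)$, where $\mathbb{C}\mathbb{Z}_n$ has basis $\{e_x\}_{x\in\mathbb{Z}_n}$ and $\lambda_t(e_x)=e_{x\triangleright t}$. Let $R_t:\mathbb{Z}_n\to\mathbb{Z}_n$, $R_t(x)=x\triangleright t$, and let $\mathrm{Inn}(\mathbb{Z}_n)$ be the group generated by the $R_t$; it is generated by $R_1,R_2$. Quandle subrepresentations of $\mathbb{C}\mathbb{Z}_n$ are the same as its subrepresentations as a group representation of $\mathrm{Inn}(\mathbb{Z}_n)$. Let $D_m=\langle\alpha,\beta\mid\alpha^2=\beta^2=(\alpha\beta)^m=1\rangle$, with $m=n/2$ if $n$ is even and $m=n$ if $n$ is odd; $\mathbb{C}\mathbb{Z}_n$ is regarded as a representation of $D_m$ through the homomorphism $D_m\to\mathrm{Inn}(\mathbb{Z}_n)$, $\alpha\mapsto R_1$, $\beta\mapsto R_2$ (so $\alpha$ acts by $\lambda_1$ and $\beta$ by $\lambda_2$), and the isomorphisms in the claim are isomorphisms of $D_m$-representations. Put $\omega_r=e^{2\pi i/r}$.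 For $\lambda,\mu\in\mathbb{C}$, $\mathbb{C}(\lambda,\mu)$ is the one-dimensional representation of $D_m$ on which $\alpha$ and $\beta$ act by the scalars $\lambda$ and $\mu$. For $s\in\mathbb{Z}$, $W(\omega_m^s)$ is the two-dimensional representation of $D_m$ with $\alpha\mapsto\begin{bmatrix}0&1\\1&0\end{bmatrix}$ and $\beta\mapsto\begin{bmatrix}0&\omega_m^s\\ \omega_m^{-s}&0\end{bmatrix}$. *)

theory Defs
  imports Complex_Main "HOL-Library.Function_Algebras" "HOL-Algebra.Bij"
begin

subsection \<open>Complex vector spaces\<close>

class scaleC =
  fixes scaleC :: "complex \<Rightarrow> 'a \<Rightarrow> 'a" (infixr "*\<^sub>C" 75)

class complex_vector = scaleC + ab_group_add +
  assumes scaleC_add_right: "a *\<^sub>C (x + y) = a *\<^sub>C x + a *\<^sub>C y"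
    and scaleC_add_left: "(a + b) *\<^sub>C x = a *\<^sub>C x + b *\<^sub>C x"
    and scaleC_scaleC: "a *\<^sub>C b *\<^sub>C x = (a * b) *\<^sub>C x"
    and scaleC_one: "1 *\<^sub>C x = x"

global_interpretation complex_vector: vector_space "scaleC :: complex \<Rightarrow> 'a \<Rightarrow> 'a::complex_vector"
  by unfold_locales (rule scaleC_add_right scaleC_add_left scaleC_scaleC scaleC_one)+

instantiation complex :: complex_vector
begin

definition scaleC_complex :: "complex \<Rightarrow> complex \<Rightarrow> complex" where
  "scaleC_complex a x = a * x"

instance
  by standard (simp_all add: scaleC_complex_def algebra_simps)

end

instantiation "fun" :: (type, complex_vector) complex_vector
begin

definition scaleC_fun :: "complex \<Rightarrow> ('a \<Rightarrow> 'b) \<Rightarrow> 'a \<Rightarrow> 'b" where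
  "scaleC_fun a f = (\<lambda>x. a *\<^sub>C f x)"

instance
  by standard (simp_all add: scaleC_fun_def fun_eq_iff scaleC_add_right scaleC_add_left
      scaleC_scaleC scaleC_one)

end

text \<open>
  A finite-dimensional complex vector space is a finite-dimensional subspace of some type of class
  \<open>complex_vector\<close>, so that spaces of varying dimension can share one type.
\<close>

definition fin_dim_space :: "'v::complex_vector set \<Rightarrow> bool" where
  "fin_dim_space V \<longleftrightarrow> (\<exists>B. finite B \<and> V = complex_vector.span B)"

definition linear_map_on :: "'v::complex_vector set \<Rightarrow> ('v \<Rightarrow> 'w::complex_vector) \<Rightarrow> bool" where
  "linear_map_on V f \<longleftrightarrow>
     (\<forall>u\<in>V. \<forall>v\<in>V. f (u + v) = f u + f v) \<and> (\<forall>c. \<forall>v\<in>V. f (c *\<^sub>C v) = c *\<^sub>C f v)"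

text \<open>
  As in \<open>BijGroup\<close>, operators on \<open>V\<close> are taken to be \<open>undefined\<close> outside \<open>V\<close>; multiplication is
  composition.
\<close>

definition GL :: "'v::complex_vector set \<Rightarrow> ('v \<Rightarrow> 'v) monoid" where
  "GL V = (BijGroup V)\<lparr>carrier := {f \<in> Bij V. linear_map_on V f}\<rparr>"

text \<open>A space together with an action of \<open>'x\<close> (a quandle or a group) on it.\<close>

record ('x, 'v) rep =
  rspace :: "'v set"
  raction :: "'x \<Rightarrow> 'v \<Rightarrow> 'v"


subsection \<open>Quandles and their representations\<close>

record 'x quandle =
  qset :: "'x set"
  qop :: "'x \<Rightarrow> 'x \<Rightarrow> 'x" (infixl "\<triangleright>\<index>" 70)

definition is_quandle :: "'x quandle \<Rightarrow> bool" where
  "is_quandle X \<longleftrightarrow>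
     (\<forall>x\<in>qset X. x \<triangleright>\<^bsub>X\<^esub> x = x) \<and>
     (\<forall>y\<in>qset X. bij_betw (\<lambda>x. x \<triangleright>\<^bsub>X\<^esub> y) (qset X) (qset X)) \<and>
     (\<forall>x\<in>qset X. \<forall>y\<in>qset X. \<forall>z\<in>qset X.
        (x \<triangleright>\<^bsub>X\<^esub> y) \<triangleright>\<^bsub>X\<^esub> z = (x \<triangleright>\<^bsub>X\<^esub> z) \<triangleright>\<^bsub>X\<^esub> (y \<triangleright>\<^bsub>X\<^esub> z))"

definition quandle_rep :: "'x quandle \<Rightarrow> ('x, 'v::complex_vector) rep \<Rightarrow> bool" where
  "quandle_rep X A \<longleftrightarrow>
     is_quandle X \<and> fin_dim_space (rspace A) \<and>
     raction A \<in> qset X \<rightarrow> carrier (GL (rspace A)) \<and>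
     (\<forall>x\<in>qset X. \<forall>y\<in>qset X.
        raction A (x \<triangleright>\<^bsub>X\<^esub> y) =
        raction A y \<otimes>\<^bsub>GL (rspace A)\<^esub> raction A x
          \<otimes>\<^bsub>GL (rspace A)\<^esub> inv\<^bsub>GL (rspace A)\<^esub> (raction A y))"

definition quandle_subrep :: "'x quandle \<Rightarrow> ('x, 'v::complex_vector) rep \<Rightarrow> 'v set \<Rightarrow> bool" where
  "quandle_subrep X A U \<longleftrightarrow>
     complex_vector.subspace U \<and> U \<subseteq> rspace A \<and> (\<forall>x\<in>qset X. raction A x ` U \<subseteq> U)"

definition subrep_on :: "('x, 'v) rep \<Rightarrow> 'v set \<Rightarrow> ('x, 'v) rep" where
  "subrep_on A U = \<lparr>rspace = U, raction = (\<lambda>x. restrict (raction A x) U)\<rparr>"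

definition quandle_irreducible :: "'x quandle \<Rightarrow> ('x, 'v::complex_vector) rep \<Rightarrow> bool" where
  "quandle_irreducible X A \<longleftrightarrow>
     quandle_rep X A \<and> rspace A \<noteq> {0} \<and>
     (\<forall>U. quandle_subrep X A U \<longrightarrow> U = {0} \<or> U = rspace A)"

text \<open>For a finite quandle \<open>X\<close>, the space \<open>\<complex>X\<close> consists of the functions vanishing outside \<open>X\<close>.\<close>

definition basis_vec :: "'x \<Rightarrow> 'x \<Rightarrow> complex" where
  "basis_vec x = (\<lambda>y. if y = x then 1 else 0)"

definition regular_rep :: "'x quandle \<Rightarrow> ('x, 'x \<Rightarrow> complex) rep" where
  "regular_rep X =
     \<lparr>rspace = {f. \<forall>x. x \<notin> qset X \<longrightarrow> f x = 0},
      raction = (\<lambda>t. restrict (\<lambda>f. \<Sum>x\<in>qset X. f x *\<^sub>C basis_vec (x \<triangleright>\<^bsub>X\<^esub> t))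
                   {f. \<forall>x. x \<notin> qset X \<longrightarrow> f x = 0})\<rparr>"

text \<open>The representative in \<open>{1..n}\<close> of the residue class of \<open>z\<close> modulo \<open>n\<close>.\<close>

definition residue :: "nat \<Rightarrow> int \<Rightarrow> int" where
  "residue n z = (z - 1) mod int n + 1"

definition dihedral_quandle :: "nat \<Rightarrow> int quandle" where
  "dihedral_quandle n = \<lparr>qset = {1..int n}, qop = (\<lambda>x y. residue n (2 * y - x))\<rparr>"


subsection \<open>Group presentations\<close>

text \<open>
  In a word over \<open>'a\<close>, the letter \<open>(True, x)\<close> stands for the generator \<open>x\<close> and \<open>(False, x)\<close> for its
  formal inverse. Every element of the type \<open>'a\<close> is a generator.
\<close>

type_synonym 'a word = "(bool \<times> 'a) list"

inductive pres_equiv :: "'a word set \<Rightarrow> 'a word \<Rightarrow> 'a word \<Rightarrow> bool" for R where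
  refl: "pres_equiv R u u"
| sym: "pres_equiv R u v \<Longrightarrow> pres_equiv R v u"
| trans: "pres_equiv R u v \<Longrightarrow> pres_equiv R v w \<Longrightarrow> pres_equiv R u w"
| cancel: "pres_equiv R (u @ [(b, x), (\<not> b, x)] @ v) (u @ v)"
| relator: "r \<in> R \<Longrightarrow> pres_equiv R (u @ r @ v) (u @ v)"

definition pres_rel :: "'a word set \<Rightarrow> ('a word \<times> 'a word) set" where
  "pres_rel R = {(u, v). pres_equiv R u v}"

definition presented_group :: "'a word set \<Rightarrow> 'a word set monoid" where
  "presented_group R =
     \<lparr>carrier = UNIV // pres_rel R,
      mult = (\<lambda>P Q. \<Union>u\<in>P. \<Union>v\<in>Q. pres_rel R `` {u @ v}),
      one = pres_rel R `` {[]}\<rparr>"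

definition eval_word :: "('b, 'c) monoid_scheme \<Rightarrow> ('a \<Rightarrow> 'b) \<Rightarrow> 'a word \<Rightarrow> 'b" where
  "eval_word H f w =
     foldr (\<lambda>(b, x) h. (if b then f x else inv\<^bsub>H\<^esub> (f x)) \<otimes>\<^bsub>H\<^esub> h) w \<one>\<^bsub>H\<^esub>"

text \<open>
  The homomorphism into \<open>H\<close> induced by \<open>f\<close> on generators. It is meaningful only if \<open>f\<close> respects the
  relators, in which case \<open>eval_word H f\<close> is constant on each class \<open>P\<close>.
\<close>

definition induced_hom :: "('b, 'c) monoid_scheme \<Rightarrow> ('a \<Rightarrow> 'b) \<Rightarrow> 'a word set \<Rightarrow> 'b" where
  "induced_hom H f P = the_elem (eval_word H f ` P)"

datatype dgen = Alpha | Beta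

definition dihedral :: "nat \<Rightarrow> dgen word set monoid" where
  "dihedral m = presented_group
     {[(True, Alpha), (True, Alpha)],
      [(True, Beta), (True, Beta)],
      concat (replicate m [(True, Alpha), (True, Beta)])}"

abbreviation gen_map :: "'b \<Rightarrow> 'b \<Rightarrow> dgen \<Rightarrow> 'b" where
  "gen_map a b \<equiv> case_dgen a b"


subsection \<open>Group representations\<close>

definition group_rep :: "('g, 'b) monoid_scheme \<Rightarrow> ('g, 'v::complex_vector) rep \<Rightarrow> bool" where
  "group_rep G A \<longleftrightarrow>
     group G \<and> fin_dim_space (rspace A) \<and> raction A \<in> hom G (GL (rspace A))"

definition rep_iso ::
  "('g, 'b) monoid_scheme \<Rightarrow> ('g, 'v::complex_vector) rep \<Rightarrow> ('g, 'w::complex_vector) rep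
     \<Rightarrow> ('v \<Rightarrow> 'w) \<Rightarrow> bool" where
  "rep_iso G A B \<phi> \<longleftrightarrow>
     group_rep G A \<and> group_rep G B \<and>
     linear_map_on (rspace A) \<phi> \<and> bij_betw \<phi> (rspace A) (rspace B) \<and>
     (\<forall>g\<in>carrier G. \<forall>v\<in>rspace A. \<phi> (raction A g v) = raction B g (\<phi> v))"

text \<open>
  The external direct sum of a list of representations: tuples of vectors, encoded as functions
  that vanish beyond the length of the list.
\<close>

definition direct_sum_space :: "('g, 'v::complex_vector) rep list \<Rightarrow> (nat \<Rightarrow> 'v) set" where
  "direct_sum_space L =
     {F. (\<forall>i<length L. F i \<in> rspace (L ! i)) \<and> (\<forall>i\<ge>length L. F i = 0)}"

definition direct_sum :: "('g, 'v::complex_vector) rep list \<Rightarrow> ('g, nat \<Rightarrow> 'v) rep" where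
  "direct_sum L =
     \<lparr>rspace = direct_sum_space L,
      raction = (\<lambda>g. restrict
        (\<lambda>F i. if i < length L then raction (L ! i) g (F i) else 0) (direct_sum_space L))\<rparr>"

definition nth_summand :: "('g, 'v::complex_vector) rep list \<Rightarrow> nat \<Rightarrow> (nat \<Rightarrow> 'v) set" where
  "nth_summand L i = {F \<in> direct_sum_space L. \<forall>j. j \<noteq> i \<longrightarrow> F j = 0}"


subsection \<open>The representations of the dihedral group\<close>

definition coord_space :: "nat \<Rightarrow> (nat \<Rightarrow> complex) set" where
  "coord_space d = {f. \<forall>i\<ge>d. f i = 0}"

text \<open>The operator on \<open>\<complex>\<^sup>d\<close> given by the \<open>d \<times> d\<close> matrix with list of rows \<open>M\<close>.\<close>

definition matrix_op :: "nat \<Rightarrow> complex list list \<Rightarrow> (nat \<Rightarrow> complex) \<Rightarrow> nat \<Rightarrow> complex" where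
  "matrix_op d M =
     restrict (\<lambda>f i. if i < d then \<Sum>j<d. M ! i ! j * f j else 0) (coord_space d)"

definition \<omega> :: "nat \<Rightarrow> complex" where
  "\<omega> r = exp (2 * complex_of_real pi * \<i> / of_nat r)"

text \<open>\<open>\<complex>(a,b)\<close> as a representation of \<open>dihedral m\<close>\<close>

definition char_rep :: "nat \<Rightarrow> complex \<Rightarrow> complex \<Rightarrow> (dgen word set, nat \<Rightarrow> complex) rep" where
  "char_rep m a b =
     \<lparr>rspace = coord_space 1,
      raction = induced_hom (GL (coord_space 1))
        (gen_map (matrix_op 1 [[a]]) (matrix_op 1 [[b]]))\<rparr>"

text \<open>\<open>W(\<omega>\<^sub>m\<^sup>s)\<close>\<close>

definition W_rep :: "nat \<Rightarrow> int \<Rightarrow> (dgen word set, nat \<Rightarrow> complex) rep" where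
  "W_rep m s =
     \<lparr>rspace = coord_space 2,
      raction = induced_hom (GL (coord_space 2))
        (gen_map
          (matrix_op 2 [[0, 1], [1, 0]])
          (matrix_op 2 [[0, \<omega> m powi s], [\<omega> m powi (- s), 0]]))\<rparr>"

text \<open>
  \<open>\<complex>\<int>\<^sub>n\<close> as a representation of the dihedral group. The element \<open>2\<close> of \<open>\<int>\<^sub>n\<close> is
  \<open>residue n 2\<close> because \<open>2 \<notin> {1..n}\<close> when \<open>n = 1\<close>.
\<close>

definition regular_rep_dihedral :: "nat \<Rightarrow> (dgen word set, int \<Rightarrow> complex) rep" where
  "regular_rep_dihedral n =
     \<lparr>rspace = rspace (regular_rep (dihedral_quandle n)),
      raction = induced_hom (GL (rspace (regular_rep (dihedral_quandle n))))
        (gen_map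
          (raction (regular_rep (dihedral_quandle n)) (residue n 1))
          (raction (regular_rep (dihedral_quandle n)) (residue n 2)))\<rparr>"

definition dihedral_index :: "nat \<Rightarrow> nat" where
  "dihedral_index n = (if even n then n div 2 else n)"

text \<open>
  \<open>\<complex>\<int>\<^sub>n\<close> is isomorphic, as a representation of the dihedral group, to the direct sum of \<open>L\<close>, and under
  the isomorphism the summands correspond to irreducible quandle subrepresentations of \<open>\<complex>\<int>\<^sub>n\<close>.
\<close>

definition irreducible_decomposition ::
  "nat \<Rightarrow> (dgen word set, nat \<Rightarrow> complex) rep list \<Rightarrow> bool" where
  "irreducible_decomposition n L \<longleftrightarrow>
     (let X = dihedral_quandle n; A = regular_rep X in
      quandle_rep X A \<and>
      (\<exists>\<phi>. rep_iso (dihedral (dihedral_index n)) (direct_sum L) (regular_rep_dihedral n) \<phi> \<and>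
           (\<forall>i<length L.
              quandle_subrep X A (\<phi> ` nth_summand L i) \<and>
              quandle_irreducible X (subrep_on A (\<phi> ` nth_summand L i)))))"

end

theory Submission
  imports Defs
begin

text \<open>
  With \<open>\<omega> = \<omega> n\<close>, the Fourier modes \<open>v\<^sub>j = \<Sum>\<^sub>x \<omega>\<^bsup>j x\<^esup> e\<^sub>x\<close>
  form a basis of \<open>\<complex>\<int>\<^sub>n\<close>, and \<open>\<lambda>\<^sub>t v\<^sub>j = \<omega>\<^bsup>2 t j\<^esup> v\<^sub>-\<^sub>j\<close>. Hence each plane spanned by
  \<open>v\<^sub>j\<close> and \<open>v\<^sub>-\<^sub>j\<close> is invariant, and \<open>v\<^sub>j, \<omega>\<^bsup>2 j\<^esup> v\<^sub>-\<^sub>j\<close> identifies it with \<open>W\<close> of the parameter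
  \<open>\<omega>\<^bsup>- 2 j\<^esup>\<close>. It is irreducible unless \<open>n\<close> divides \<open>4 j\<close>: for \<open>2 j = 0\<close> modulo \<open>n\<close> it degenerates to a line,
  and for \<open>n = 4 k\<close>, \<open>j = k\<close> it splits into the lines of \<open>v\<^sub>k - v\<^sub>-\<^sub>k\<close> and \<open>v\<^sub>k + v\<^sub>-\<^sub>k\<close>, which are \<open>\<complex>(1,-1)\<close> and \<open>\<complex>(-1,1)\<close>.
  The sum is direct because the blocks have total dimension \<open>n\<close> and span all modes.
\<close>

subsection \<open>Presented groups\<close>

text \<open>Only 2j modulo n enters the isomorphism type of the plane of the modes j and -j. This
  explains the multiplicities. For n = 2m the indices j and j + m give the same type, so each W
  occurs twice, as does the trivial line (j = 0 and j = m), and the parameter is a power of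
  \<omega>_m because \<omega>_m is the square of \<omega>_n. For odd n doubling is invertible modulo
  n, so each type occurs once, and the parameter is an even power of \<omega>_n itself. The sign
  characters require 4j, but not 2j, to vanish modulo n, which is possible only if 4 divides n.

  The shape of the proof is dictated by the encoding of the dihedral group as classes of words, with
  every action given by \<open>induced_hom\<close>. All computations are made with the two
  generating involutions; well-definedness of the actions and equivariance under the whole group are
  transferred from the generators by induction on words. Quandle irreducibility, in contrast, is
  stated through the reflections at all t and never passes through the presentation.\<close>

lemma pres_equiv_append_left: "pres_equiv R u v \<Longrightarrow> pres_equiv R (w @ u) (w @ v)"
proof (induction rule: pres_equiv.induct)
  case (cancel u b x v)
  show ?case using pres_equiv.cancel[of R "w @ u" b x v] by simp
next
  case (relator r u v)
  then show ?case using pres_equiv.relator[of r R "w @ u" v] by simp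
qed (auto intro: pres_equiv.refl pres_equiv.sym pres_equiv.trans)

lemma pres_equiv_append_right: "pres_equiv R u v \<Longrightarrow> pres_equiv R (u @ w) (v @ w)"
proof (induction rule: pres_equiv.induct)
  case (cancel u b x v)
  show ?case using pres_equiv.cancel[of R u b x "v @ w"] by simp
next
  case (relator r u v)
  then show ?case using pres_equiv.relator[of r R u "v @ w"] by simp
qed (auto intro: pres_equiv.refl pres_equiv.sym pres_equiv.trans)

lemma pres_equiv_append:
  "pres_equiv R u u' \<Longrightarrow> pres_equiv R v v' \<Longrightarrow> pres_equiv R (u @ v) (u' @ v')"
  by (meson pres_equiv.trans pres_equiv_append_left pres_equiv_append_right)

lemma equiv_pres_rel: "equiv UNIV (pres_rel R)"
  unfolding equiv_def refl_on_def sym_def trans_def pres_rel_def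
  by (auto intro: pres_equiv.refl pres_equiv.sym pres_equiv.trans)

lemma pres_class_eq_iff: "pres_rel R `` {u} = pres_rel R `` {v} \<longleftrightarrow> pres_equiv R u v"
  using eq_equiv_class_iff[OF equiv_pres_rel, of u v] by (simp add: pres_rel_def)

lemma carrier_presented_group: "carrier (presented_group R) = range (\<lambda>u. pres_rel R `` {u})"
  by (auto simp: presented_group_def quotient_def)

lemma one_presented_group: "\<one>\<^bsub>presented_group R\<^esub> = pres_rel R `` {[]}"
  by (simp add: presented_group_def)

text \<open>Concatenation respects equivalence of words in both arguments, so the union over all
  representatives in the multiplication collapses to one class.\<close>

lemma mult_presented_group:
  "pres_rel R `` {u} \<otimes>\<^bsub>presented_group R\<^esub> pres_rel R `` {v} = pres_rel R `` {u @ v}"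
proof -
  have "(\<lambda>u v. pres_rel R `` {u @ v}) respects2 pres_rel R"
    by (simp add: congruent2_def pres_class_eq_iff) (auto simp: pres_rel_def intro: pres_equiv_append)
  then show ?thesis
    by (simp add: presented_group_def UN_equiv_class2[OF equiv_pres_rel equiv_pres_rel])
qed

text \<open>The formal inverse reverses the word and flips each letter. The two letters that meet in
  the middle cancel, which leaves the claim for the shorter word.\<close>

lemma pres_equiv_inverse_word:
  "pres_equiv R (rev (map (map_prod Not id) w) @ w) []"
proof (induction w)
  case (Cons a w)
  obtain b x where a: "a = (b, x)" by fastforce
  have "pres_equiv R (rev (map (map_prod Not id) w) @ [(\<not> b, x), (\<not> \<not> b, x)] @ w)
      (rev (map (map_prod Not id) w) @ w)"
    by (rule pres_equiv.cancel)
  from pres_equiv.trans[OF this Cons.IH] show ?case by (simp add: a id_def)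
qed (simp add: pres_equiv.refl)

lemma group_presented_group: "group (presented_group R)"
proof (rule groupI)
  fix P assume "P \<in> carrier (presented_group R)"
  then obtain w where "P = pres_rel R `` {w}" by (auto simp: carrier_presented_group)
  then show "\<exists>Q\<in>carrier (presented_group R). Q \<otimes>\<^bsub>presented_group R\<^esub> P = \<one>\<^bsub>presented_group R\<^esub>"
    by (intro bexI[of _ "pres_rel R `` {rev (map (map_prod Not id) w)}"])
      (auto simp: carrier_presented_group mult_presented_group one_presented_group
        pres_class_eq_iff pres_equiv_inverse_word)
qed (auto simp: carrier_presented_group mult_presented_group one_presented_group)

section \<open>Evaluation of words and homomorphisms out of a presented group\<close>

lemma (in group) eval_word_closed:
  assumes "range f \<subseteq> carrier G"
  shows "eval_word G f w \<in> carrier G"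
proof (induction w)
  case (Cons a w)
  have "f (snd a) \<in> carrier G" using assms by auto
  with Cons show ?case by (auto simp: eval_word_def split: prod.splits)
qed (simp add: eval_word_def)

lemma (in group) eval_word_append:
  assumes "range f \<subseteq> carrier G"
  shows "eval_word G f (u @ v) = eval_word G f u \<otimes> eval_word G f v"
proof (induction u)
  case (Cons a u)
  have "f (snd a) \<in> carrier G" using assms by auto
  then show ?case
    using Cons eval_word_closed[OF assms, of u] eval_word_closed[OF assms, of v]
    by (auto simp: eval_word_def m_assoc split: prod.splits)
qed (use eval_word_closed[OF assms, of v] in \<open>simp add: eval_word_def\<close>)

text \<open>Von Dyck's argument: each generating step of the equivalence inserts or deletes a
  subword of value one. This is what makes \<open>induced_hom\<close> meaningful.\<close>

lemma (in group) eval_word_cong: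
  assumes f: "range f \<subseteq> carrier G" and R: "\<And>r. r \<in> R \<Longrightarrow> eval_word G f r = \<one>"
    and "pres_equiv R u v"
  shows "eval_word G f u = eval_word G f v"
  using assms(3)
proof (induction rule: pres_equiv.induct)
  case (cancel u b x v)
  have "f x \<in> carrier G" using f by auto
  then have "eval_word G f [(b, x), (\<not> b, x)] = \<one>" by (simp add: eval_word_def)
  then show ?case by (simp only: eval_word_append[OF f] l_one eval_word_closed[OF f])
next
  case (relator r u v)
  then show ?case by (simp add: eval_word_append[OF f] R eval_word_closed[OF f])
qed auto

text \<open>The image of a class under evaluation is a singleton, so \<open>the_elem\<close> returns
  the value at any representative.\<close>

lemma (in group) induced_hom_class:
  assumes "range f \<subseteq> carrier G" and "\<And>r. r \<in> R \<Longrightarrow> eval_word G f r = \<one>"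
  shows "induced_hom G f (pres_rel R `` {u}) = eval_word G f u"
proof -
  have "eval_word G f ` (pres_rel R `` {u}) = {eval_word G f u}"
    using eval_word_cong[OF assms] by (auto simp: pres_rel_def intro: pres_equiv.refl)
  then show ?thesis by (simp add: induced_hom_def)
qed

lemma (in group) induced_hom_hom:
  assumes "range f \<subseteq> carrier G" and "\<And>r. r \<in> R \<Longrightarrow> eval_word G f r = \<one>"
  shows "induced_hom G f \<in> hom (presented_group R) G"
  by (rule homI) (auto simp: carrier_presented_group mult_presented_group
      induced_hom_class[OF assms] eval_word_append[OF assms(1)] intro: eval_word_closed[OF assms(1)])

lemma (in group) eval_word_replicate:
  assumes "range f \<subseteq> carrier G"
  shows "eval_word G f (concat (replicate m w)) = eval_word G f w [^] m"
  by (induction m)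
    (simp_all add: eval_word_append[OF assms] eval_word_closed[OF assms] nat_pow_Suc2 flip: nat_pow_Suc2,
     simp_all add: eval_word_def)


subsection \<open>General linear groups and involutions\<close>

lemma carrier_GL: "carrier (GL V) = {f \<in> Bij V. linear_map_on V f}"
  by (simp add: GL_def)

lemma GL_closed: "a \<in> carrier (GL V) \<Longrightarrow> v \<in> V \<Longrightarrow> a v \<in> V"
  using Bij_imp_funcset by (fastforce simp: carrier_GL)

lemma GL_linear: "a \<in> carrier (GL V) \<Longrightarrow> linear_map_on V a"
  by (simp add: carrier_GL)

lemma GL_mult_apply:
  "a \<in> carrier (GL V) \<Longrightarrow> b \<in> carrier (GL V) \<Longrightarrow> v \<in> V \<Longrightarrow> (a \<otimes>\<^bsub>GL V\<^esub> b) v = a (b v)"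
  by (simp add: GL_def BijGroup_def compose_def)

lemma GL_one_apply: "v \<in> V \<Longrightarrow> \<one>\<^bsub>GL V\<^esub> v = v"
  by (simp add: GL_def BijGroup_def)

lemma GL_eqI:
  assumes "a \<in> carrier (GL V)" "b \<in> carrier (GL V)" "\<And>v. v \<in> V \<Longrightarrow> a v = b v"
  shows "a = b"
  by (rule extensionalityI[of _ V]) (use assms in \<open>auto simp: carrier_GL Bij_def\<close>)

lemma linear_map_on_inv_into:
  assumes "complex_vector.subspace V" "f \<in> Bij V" "linear_map_on V f"
  shows "linear_map_on V (restrict (inv_into V f) V)"
proof -
  note sub = complex_vector.subspace_add[OF assms(1)] complex_vector.subspace_scale[OF assms(1)]
  have inj: "inj_on f V" and im: "f ` V = V" using assms(2) by (auto simp: Bij_def bij_betw_def)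
  have eq: "inv_into V f y = x" if "x \<in> V" "f x = y" for x y
    using that inj by auto
  have mem: "inv_into V f y \<in> V" and val: "f (inv_into V f y) = y" if "y \<in> V" for y
    using that im by (auto intro: inv_into_into f_inv_into_f)
  show ?thesis
    unfolding linear_map_on_def
  proof (intro conjI ballI allI)
    fix u v assume "u \<in> V" "v \<in> V"
    then show "restrict (inv_into V f) V (u + v) =
        restrict (inv_into V f) V u + restrict (inv_into V f) V v"
      using assms(3) by (auto simp: sub mem val linear_map_on_def intro!: eq)
  next
    fix c v assume "v \<in> V"
    then show "restrict (inv_into V f) V (c *\<^sub>C v) = c *\<^sub>C restrict (inv_into V f) V v"
      using assms(3) by (auto simp: sub mem val linear_map_on_def intro!: eq)
  qed
qed

text \<open>The linear bijections form a subgroup of \<open>BijGroup V\<close>; the nontrivial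
  closure condition, linearity of inverses, is \<open>linear_map_on_inv_into\<close>.\<close>

lemma group_GL:
  assumes "complex_vector.subspace V"
  shows "group (GL V)"
proof -
  interpret group "BijGroup V" by (rule group_BijGroup)
  have "subgroup {f \<in> Bij V. linear_map_on V f} (BijGroup V)"
  proof (rule subgroupI)
    show "{f \<in> Bij V. linear_map_on V f} \<noteq> {}"
      using id_Bij[of V] complex_vector.subspace_add[OF assms] complex_vector.subspace_scale[OF assms]
      by (auto simp: linear_map_on_def intro!: exI[of _ "\<lambda>x\<in>V. x"])
  next
    fix f assume "f \<in> {f \<in> Bij V. linear_map_on V f}"
    then show "inv\<^bsub>BijGroup V\<^esub> f \<in> {f \<in> Bij V. linear_map_on V f}"
      using linear_map_on_inv_into[OF assms] restrict_inv_into_Bij by (auto simp: inv_BijGroup)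
  next
    fix f g assume "f \<in> {f \<in> Bij V. linear_map_on V f}" "g \<in> {f \<in> Bij V. linear_map_on V f}"
    then show "f \<otimes>\<^bsub>BijGroup V\<^esub> g \<in> {f \<in> Bij V. linear_map_on V f}"
      using complex_vector.subspace_add[OF assms] complex_vector.subspace_scale[OF assms]
        Bij_imp_funcset[of g V] compose_Bij[of f V g]
      by (auto simp: BijGroup_def linear_map_on_def compose_def Pi_iff)
  qed (auto simp: BijGroup_def)
  then show ?thesis unfolding GL_def by (rule subgroup_imp_group)
qed

text \<open>A map that is its own inverse is bijective. Every reflection and every generator matrix
  below is an involution, so this is how they enter \<open>GL V\<close>.\<close>

lemma involution_in_GL:
  assumes "\<And>v. v \<in> V \<Longrightarrow> T v \<in> V" "\<And>v. v \<in> V \<Longrightarrow> T (T v) = v" "linear_map_on V T"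
    and "complex_vector.subspace V"
  shows "restrict T V \<in> carrier (GL V)"
proof -
  have "bij_betw T V V"
    by (rule bij_betwI[where g = T]) (use assms in auto)
  then show ?thesis
    using assms complex_vector.subspace_add[OF assms(4)] complex_vector.subspace_scale[OF assms(4)]
    by (auto simp: carrier_GL Bij_def linear_map_on_def cong: bij_betw_cong)
qed

lemma inv_GL_involution:
  assumes "complex_vector.subspace V" "a \<in> carrier (GL V)" "\<And>v. v \<in> V \<Longrightarrow> a (a v) = v"
  shows "inv\<^bsub>GL V\<^esub> a = a"
proof -
  interpret group "GL V" by (rule group_GL[OF assms(1)])
  have "a \<otimes>\<^bsub>GL V\<^esub> a = \<one>\<^bsub>GL V\<^esub>"
    by (rule GL_eqI[of _ V]) (use assms in \<open>auto simp: GL_mult_apply GL_one_apply\<close>)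
  then show ?thesis using assms(2) by (intro inv_equality)
qed

lemma GL_pow_apply:
  assumes "complex_vector.subspace V" "a \<in> carrier (GL V)" "v \<in> V"
  shows "(a [^]\<^bsub>GL V\<^esub> (m::nat)) v = (a ^^ m) v"
proof -
  interpret group "GL V" by (rule group_GL[OF assms(1)])
  show ?thesis using assms(2,3)
    by (induction m arbitrary: v) (simp_all add: GL_one_apply GL_mult_apply GL_closed funpow_swap1)
qed

text \<open>By induction on the word it suffices to treat one letter. Letters that stand for
  generators are covered by the hypothesis; inverse letters follow by cancelling
  \<open>g x\<close>.\<close>

lemma eval_word_intertwining:
  assumes V: "complex_vector.subspace V" and W: "complex_vector.subspace W"
    and f: "range f \<subseteq> carrier (GL V)" and g: "range g \<subseteq> carrier (GL W)"
    and \<phi>: "\<And>v. v \<in> V \<Longrightarrow> \<phi> v \<in> W" "\<And>x v. v \<in> V \<Longrightarrow> \<phi> (f x v) = g x (\<phi> v)"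
    and "v \<in> V"
  shows "\<phi> (eval_word (GL V) f w v) = eval_word (GL W) g w (\<phi> v)"
proof (induction w)
  case Nil
  show ?case using \<phi>(1) \<open>v \<in> V\<close> by (simp add: eval_word_def GL_one_apply)
next
  case (Cons c w)
  obtain b x where c: "c = (b, x)" by fastforce
  interpret V: group "GL V" by (rule group_GL[OF V])
  interpret W: group "GL W" by (rule group_GL[OF W])
  define f' g' where "f' = (if b then f x else inv\<^bsub>GL V\<^esub> (f x))"
    and "g' = (if b then g x else inv\<^bsub>GL W\<^esub> (g x))"
  have fx: "f x \<in> carrier (GL V)" and gx: "g x \<in> carrier (GL W)" using f g by auto
  have f': "f' \<in> carrier (GL V)" and g': "g' \<in> carrier (GL W)"
    using fx gx by (auto simp: f'_def g'_def)
  have *: "\<phi> (f' u) = g' (\<phi> u)" if u: "u \<in> V" for u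
  proof (cases b)
    case True
    then show ?thesis using u \<phi>(2) by (simp add: f'_def g'_def)
  next
    case False
    have u': "f' u \<in> V" using f' u by (rule GL_closed)
    have "f x (f' u) = u"
      using GL_mult_apply[OF fx f' u] u fx False by (simp add: f'_def GL_one_apply)
    \<comment> \<open>The hypothesis is applied to the preimage \<open>f' u\<close>; applying
      \<open>g'\<close> to both sides then removes \<open>g x\<close>.\<close>
    then have "\<phi> u = g x (\<phi> (f' u))" using \<phi>(2)[OF u'] by metis
    moreover have "g' (g x w) = w" if "w \<in> W" for w
      using GL_mult_apply[OF g' gx that] that gx False by (simp add: g'_def GL_one_apply)
    ultimately show ?thesis using \<phi>(1)[OF u'] by metis
  qed
  have cv: "eval_word (GL V) f w \<in> carrier (GL V)" and cw: "eval_word (GL W) g w \<in> carrier (GL W)"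
    using f g by (auto intro!: V.eval_word_closed W.eval_word_closed)
  have "\<phi> (eval_word (GL V) f (c # w) v) = \<phi> (f' (eval_word (GL V) f w v))"
    using GL_mult_apply[OF f' cv \<open>v \<in> V\<close>] by (simp add: c eval_word_def f'_def)
  also have "\<dots> = g' (eval_word (GL W) g w (\<phi> v))"
    using * GL_closed[OF cv \<open>v \<in> V\<close>] Cons.IH by simp
  also have "\<dots> = eval_word (GL W) g (c # w) (\<phi> v)"
    using GL_mult_apply[OF g' cw \<phi>(1)[OF \<open>v \<in> V\<close>]] by (simp add: c eval_word_def g'_def)
  finally show ?case .
qed

section \<open>Representations of the dihedral group from two involutions\<close>

lemma subspace_fin_dim_space: "fin_dim_space V \<Longrightarrow> complex_vector.subspace V"
  by (auto simp: fin_dim_space_def)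

text \<open>Exactly the data that the presentation demands, with the relations as pointwise
  identities on \<open>V\<close>, where they can be computed. The regular representation, the
  characters and the planes W all become instances.\<close>

locale dihedral_action =
  fixes m :: nat and V :: "'v::complex_vector set" and a b :: "'v \<Rightarrow> 'v"
  assumes fin_dim: "fin_dim_space V"
    and a_GL: "a \<in> carrier (GL V)" and b_GL: "b \<in> carrier (GL V)"
    and a_a: "v \<in> V \<Longrightarrow> a (a v) = v" and b_b: "v \<in> V \<Longrightarrow> b (b v) = v"
    and a_b_pow: "v \<in> V \<Longrightarrow> ((\<lambda>v. a (b v)) ^^ m) v = v"
begin

abbreviation rep where "rep \<equiv> \<lparr>rspace = V, raction = induced_hom (GL V) (gen_map a b)\<rparr>"

abbreviation relators :: "dgen word set" where
  "relators \<equiv> {[(True, Alpha), (True, Alpha)], [(True, Beta), (True, Beta)],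
      concat (replicate m [(True, Alpha), (True, Beta)])}"

lemma subspace: "complex_vector.subspace V"
  using fin_dim by (rule subspace_fin_dim_space)

sublocale group "GL V"
  by (rule group_GL[OF subspace])

lemma range_gens: "range (gen_map a b) \<subseteq> carrier (GL V)"
  using a_GL b_GL by (auto split: dgen.splits)

lemma relators_trivial:
  assumes "r \<in> relators"
  shows "eval_word (GL V) (gen_map a b) r = \<one>\<^bsub>GL V\<^esub>"
proof -
  have mult: "eval_word (GL V) (gen_map a b) [(True, x), (True, y)] =
      gen_map a b x \<otimes>\<^bsub>GL V\<^esub> gen_map a b y" for x y
    using range_gens by (auto simp: eval_word_def image_subset_iff)
  have "((a \<otimes>\<^bsub>GL V\<^esub> b) ^^ m) v = v" if "v \<in> V" for v
  proof -
    \<comment> \<open>The product in \<open>GL V\<close> agrees with plain composition only on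
      \<open>V\<close>, so agreement of the iterates and their membership in \<open>V\<close> are
      proved together.\<close>
    have "((a \<otimes>\<^bsub>GL V\<^esub> b) ^^ k) v = ((\<lambda>v. a (b v)) ^^ k) v \<and> ((\<lambda>v. a (b v)) ^^ k) v \<in> V" for k
      using a_GL b_GL that by (induction k) (simp_all add: GL_mult_apply GL_closed)
    then show ?thesis using a_b_pow[OF that] by simp
  qed
  then have "(a \<otimes>\<^bsub>GL V\<^esub> b) [^]\<^bsub>GL V\<^esub> m = \<one>\<^bsub>GL V\<^esub>"
    using a_GL b_GL by (intro GL_eqI[of _ V]) (auto simp: GL_pow_apply[OF subspace] GL_one_apply)
  moreover have "a \<otimes>\<^bsub>GL V\<^esub> a = \<one>\<^bsub>GL V\<^esub>" "b \<otimes>\<^bsub>GL V\<^esub> b = \<one>\<^bsub>GL V\<^esub>"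
    using a_GL b_GL a_a b_b by (auto intro!: GL_eqI[of _ V] simp: GL_mult_apply GL_one_apply)
  ultimately show ?thesis
    using assms by (auto simp: mult eval_word_replicate[OF range_gens])
qed

lemma raction_class: "raction rep (pres_rel relators `` {w}) = eval_word (GL V) (gen_map a b) w"
  using induced_hom_class[OF range_gens, of relators, OF relators_trivial] by simp

lemma group_rep: "group_rep (dihedral m) rep"
  using induced_hom_hom[OF range_gens, of relators, OF relators_trivial] fin_dim
  by (simp add: group_rep_def dihedral_def group_presented_group)

end

text \<open>Every group element is the class of a word, and on classes both actions are word
  evaluation; hence equivariance need only be checked on the two generators.\<close>

lemma dihedral_intertwining:
  assumes "dihedral_action m V a b" "dihedral_action m W a' b'"
    and "\<And>v. v \<in> V \<Longrightarrow> \<phi> v \<in> W" "\<And>v. v \<in> V \<Longrightarrow> \<phi> (a v) = a' (\<phi> v)" "\<And>v. v \<in> V \<Longrightarrow> \<phi> (b v) = b' (\<phi> v)"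
    and "g \<in> carrier (dihedral m)" "v \<in> V"
  shows "\<phi> (induced_hom (GL V) (gen_map a b) g v) = induced_hom (GL W) (gen_map a' b') g (\<phi> v)"
proof -
  interpret V: dihedral_action m V a b by fact
  interpret W: dihedral_action m W a' b' by fact
  obtain w where w: "g = pres_rel V.relators `` {w}"
    using assms(6) by (auto simp: dihedral_def carrier_presented_group)
  show ?thesis
    using V.raction_class[of w] W.raction_class[of w] assms(3-5,7)
    by (auto simp: w split: dgen.splits
        intro!: eval_word_intertwining V.subspace W.subspace V.range_gens[THEN subsetD] W.range_gens[THEN subsetD])
qed


subsection \<open>Direct sums and linear combinations\<close>

lemma scaleC_fun_apply [simp]: "(c *\<^sub>C f) x = c *\<^sub>C f x"
  by (simp add: scaleC_fun_def)

lemma scaleC_complex [simp]: "c *\<^sub>C (z::complex) = c * z"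
  by (simp add: scaleC_complex_def)

lemma sum_fun_apply [simp]: "(\<Sum>i\<in>I. f i) x = (\<Sum>i\<in>I. f i x)"
  by (induction I rule: infinite_finite_induct) auto

lemma linear_map_on_sum:
  assumes "complex_vector.subspace V" "linear_map_on V f" "\<And>i. i \<in> I \<Longrightarrow> x i \<in> V"
  shows "f (\<Sum>i\<in>I. x i) = (\<Sum>i\<in>I. f (x i))"
proof -
  \<comment> \<open>The value at zero, needed for the empty sum, comes from homogeneity with the
    scalar 0.\<close>
  have "f (0 *\<^sub>C 0) = 0 *\<^sub>C f 0"
    using assms(2) complex_vector.subspace_0[OF assms(1)] by (simp only: linear_map_on_def)
  then have "f 0 = 0" by simp
  with assms show ?thesis
    by (induction I rule: infinite_finite_induct)
      (auto simp: linear_map_on_def complex_vector.subspace_sum)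
qed

lemma group_rep_fin_dim: "group_rep G A \<Longrightarrow> fin_dim_space (rspace A)"
  by (simp add: group_rep_def)

lemma group_rep_in_GL: "group_rep G A \<Longrightarrow> g \<in> carrier G \<Longrightarrow> raction A g \<in> carrier (GL (rspace A))"
  by (auto simp: group_rep_def hom_def)

lemma group_rep_mult:
  assumes "group_rep G A" "g \<in> carrier G" "h \<in> carrier G" "v \<in> rspace A"
  shows "raction A (g \<otimes>\<^bsub>G\<^esub> h) v = raction A g (raction A h v)"
  using assms GL_mult_apply[OF group_rep_in_GL[OF assms(1,2)] group_rep_in_GL[OF assms(1,3)]]
  by (auto simp: group_rep_def hom_mult)

lemma group_rep_one:
  assumes "group_rep G A" "v \<in> rspace A"
  shows "raction A \<one>\<^bsub>G\<^esub> v = v"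
proof -
  have "raction A \<one>\<^bsub>G\<^esub> = \<one>\<^bsub>GL (rspace A)\<^esub>"
    using assms(1) by (intro hom_one group_GL subspace_fin_dim_space) (auto simp: group_rep_def)
  then show ?thesis using assms(2) by (simp add: GL_one_apply)
qed

lemma subspace_direct_sum_space:
  assumes "\<And>A. A \<in> set L \<Longrightarrow> complex_vector.subspace (rspace A)"
  shows "complex_vector.subspace (direct_sum_space L)"
  using assms
  by (auto simp: direct_sum_space_def complex_vector.subspace_def)

text \<open>Finite generating sets of the summands, each placed in its own slot by
  \<open>single\<close>, generate together, because a tuple is the sum of its one-slot
  parts.\<close>

lemma fin_dim_direct_sum_space:
  fixes L :: "('g, 'v::complex_vector) rep list"
  assumes "\<And>A. A \<in> set L \<Longrightarrow> fin_dim_space (rspace A)"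
  shows "fin_dim_space (direct_sum_space L)"
proof -
  define single :: "nat \<Rightarrow> 'v \<Rightarrow> nat \<Rightarrow> 'v" where "single = (\<lambda>i v j. if j = i then v else 0)"
  have "\<exists>B. finite B \<and> rspace (L ! i) = complex_vector.span B" if "i < length L" for i
    using assms that by (auto simp: fin_dim_space_def)
  then obtain B where B: "\<And>i. i < length L \<Longrightarrow> finite (B i)"
      "\<And>i. i < length L \<Longrightarrow> rspace (L ! i) = complex_vector.span (B i)"
    by metis
  define S where "S = (\<Union>i<length L. single i ` B i)"
  have sub: "complex_vector.subspace (direct_sum_space L)"
    using assms by (intro subspace_direct_sum_space subspace_fin_dim_space)
  have add: "single i (u + v) = single i u + single i v" for i u v
    by (auto simp: single_def fun_eq_iff)
  have scale: "single i (c *\<^sub>C v) = c *\<^sub>C single i v" for i c v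
    by (auto simp: single_def fun_eq_iff)
  have "S \<subseteq> direct_sum_space L"
    using B by (auto simp: S_def single_def direct_sum_space_def
        complex_vector.span_base complex_vector.span_zero)
  then have "complex_vector.span S \<subseteq> direct_sum_space L"
    using sub by (rule complex_vector.span_minimal)
  moreover have "direct_sum_space L \<subseteq> complex_vector.span S"
  proof
    fix F assume F: "F \<in> direct_sum_space L"
    have "single i v \<in> complex_vector.span S" if "i < length L" "v \<in> complex_vector.span (B i)" for i v
      using that(2)
    proof (induction rule: complex_vector.span_induct_alt)
      case base
      have "single i 0 = 0" by (auto simp: single_def fun_eq_iff)
      show ?case unfolding \<open>single i 0 = 0\<close> by (rule complex_vector.span_zero)
    next
      case (step c x y)
      have "single i x \<in> complex_vector.span S"
        using step that(1) by (intro complex_vector.span_base) (auto simp: S_def)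
      with step show ?case
        unfolding add scale by (intro complex_vector.span_add complex_vector.span_scale)
    qed
    then have "(\<Sum>i<length L. single i (F i)) \<in> complex_vector.span S"
      using F B(2) by (intro complex_vector.span_sum) (auto simp: direct_sum_space_def)
    also have "(\<Sum>i<length L. single i (F i)) = F"
      using F by (auto simp: fun_eq_iff single_def direct_sum_space_def sum.delta)
    finally show "F \<in> complex_vector.span S" .
  qed
  moreover have "finite S" using B by (auto simp: S_def)
  ultimately show ?thesis by (auto simp: fin_dim_space_def)
qed

lemma group_rep_direct_sum:
  fixes L :: "('g, 'v::complex_vector) rep list"
  assumes G: "group G" and L: "\<And>A. A \<in> set L \<Longrightarrow> group_rep G A"
  shows "group_rep G (direct_sum L)"
proof -
  interpret G: group G by fact
  define V where "V = direct_sum_space L"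
  define T where "T g F i = (if i < length L then raction (L ! i) g (F i) else 0)"
    for g and F :: "nat \<Rightarrow> 'v" and i
  have Li: "group_rep G (L ! i)" if "i < length L" for i using L that by simp
  have lin: "linear_map_on (rspace (L ! i)) (raction (L ! i) g)" if "i < length L" "g \<in> carrier G" for i g
    by (rule GL_linear[OF group_rep_in_GL[OF Li[OF that(1)] that(2)]])
  have V: "fin_dim_space V"
    using L by (auto simp: V_def intro!: fin_dim_direct_sum_space intro: group_rep_fin_dim)
  have sub: "complex_vector.subspace V" using V by (rule subspace_fin_dim_space)
  have closed: "T g F \<in> V" if "g \<in> carrier G" "F \<in> V" for g F
    using that GL_closed[OF group_rep_in_GL[OF Li]] by (auto simp: V_def direct_sum_space_def T_def)
  have mult: "T (g \<otimes>\<^bsub>G\<^esub> h) F = T g (T h F)"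
    if "g \<in> carrier G" "h \<in> carrier G" "F \<in> V" for g h F
    using that group_rep_mult[OF Li] by (auto simp: V_def direct_sum_space_def T_def fun_eq_iff)
  have one: "T \<one>\<^bsub>G\<^esub> F = F" if "F \<in> V" for F
    using that group_rep_one[OF Li] by (auto simp: V_def direct_sum_space_def T_def fun_eq_iff)
  \<comment> \<open>The action of the inverse element is a two-sided inverse, by \<open>mult\<close>
    and \<open>one\<close>.\<close>
  have bij: "bij_betw (T g) V V" if g: "g \<in> carrier G" for g
    by (rule bij_betwI[where g = "T (inv\<^bsub>G\<^esub> g)"])
      (use g in \<open>auto simp: closed one simp flip: mult\<close>)
  have linT: "linear_map_on V (restrict (T g) V)" if g: "g \<in> carrier G" for g
    using g lin complex_vector.subspace_add[OF sub] complex_vector.subspace_scale[OF sub]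
    by (auto simp: linear_map_on_def T_def fun_eq_iff V_def direct_sum_space_def)
  have act: "raction (direct_sum L) = (\<lambda>g. restrict (T g) V)" and "rspace (direct_sum L) = V"
    by (simp_all add: direct_sum_def V_def T_def[abs_def])
  have GL: "restrict (T g) V \<in> carrier (GL V)" if "g \<in> carrier G" for g
    using bij[OF that] linT[OF that] by (auto simp: carrier_GL Bij_def cong: bij_betw_cong)
  interpret GL: group "GL V" by (rule group_GL[OF sub])
  have "(\<lambda>g. restrict (T g) V) \<in> hom G (GL V)"
    by (rule homI, rule GL, assumption, rule GL_eqI[of _ V]) (auto simp: GL GL_mult_apply closed mult)
  then show ?thesis
    using G V by (simp add: group_rep_def act \<open>rspace (direct_sum L) = V\<close>)
qed

text \<open>A repetition in the family, or a member in the span of the others, would let fewer than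
  \<open>card E\<close> vectors span the independent set \<open>E\<close>. The conclusion concerns
  an indexed family, so injectivity of \<open>b\<close> is needed besides independence of its
  image.\<close>

lemma spanning_family_independent:
  assumes I: "finite I" and E: "complex_vector.independent E" "E \<subseteq> complex_vector.span (b ` I)"
    and card: "card I \<le> card E" and sum: "(\<Sum>i\<in>I. u i *\<^sub>C b i) = 0" and "i \<in> I"
  shows "u i = 0"
proof -
  have "card E \<le> card (b ` I)"
    using complex_vector.independent_span_bound[OF _ E] I by simp
  with card card_image_le[OF I, of b] have card_eq: "card (b ` I) = card I" "card E = card (b ` I)"
    by linarith+
  then have inj: "inj_on b I" using I by (simp add: eq_card_imp_inj_on)
  have "complex_vector.independent (b ` I)"
  proof
    assume "complex_vector.dependent (b ` I)"
    then obtain a where a: "a \<in> b ` I" "a \<in> complex_vector.span (b ` I - {a})"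
      by (auto simp: complex_vector.dependent_def)
    then have "b ` I \<subseteq> complex_vector.span (b ` I - {a})"
      by (metis complex_vector.span_base insertE insert_Diff subsetI)
    then have "E \<subseteq> complex_vector.span (b ` I - {a})"
      using E(2) complex_vector.span_minimal complex_vector.subspace_span by blast
    then have "card E \<le> card (b ` I - {a})"
      using complex_vector.independent_span_bound[OF _ E(1)] I by simp
    with card_Diff1_less[of "b ` I" a] a(1) I card_eq show False by simp
  qed
  moreover have "(\<Sum>v\<in>b ` I. u (inv_into I b v) *\<^sub>C v) = 0"
    using sum by (simp add: sum.reindex[OF inj] inj)
  ultimately have "u (inv_into I b (b i)) = 0"
    using I \<open>i \<in> I\<close> complex_vector.independentD[of "b ` I" "b ` I" "\<lambda>v. u (inv_into I b v)" "b i"] by simp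
  then show ?thesis using inj \<open>i \<in> I\<close> by simp
qed

section \<open>Coordinate maps of lists of vectors\<close>

definition lin_comb :: "'v::complex_vector list \<Rightarrow> (nat \<Rightarrow> complex) \<Rightarrow> 'v" where
  "lin_comb us f = (\<Sum>c<length us. f c *\<^sub>C us ! c)"

lemma lin_comb_add: "lin_comb us (f + g) = lin_comb us f + lin_comb us g"
  by (simp add: lin_comb_def scaleC_add_left sum.distrib)

lemma lin_comb_scale: "lin_comb us (c *\<^sub>C f) = c *\<^sub>C lin_comb us f"
  by (simp add: lin_comb_def scaleC_scaleC complex_vector.scale_sum_right)

lemma lin_comb_zero: "lin_comb us 0 = 0"
  by (simp add: lin_comb_def)

lemma basis_vec_in_coord_space: "c < d \<Longrightarrow> basis_vec c \<in> coord_space d"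
  by (auto simp: basis_vec_def coord_space_def)

lemma lin_comb_basis_vec:
  assumes "c < length us"
  shows "lin_comb us (basis_vec c) = us ! c"
proof -
  have "lin_comb us (basis_vec c) = (\<Sum>j<length us. if j = c then us ! j else 0)"
    unfolding lin_comb_def basis_vec_def by (intro sum.cong) (auto simp: scaleC_one)
  then show ?thesis using assms by simp
qed

lemma subspace_coord_space: "complex_vector.subspace (coord_space d)"
  by (auto simp: complex_vector.subspace_def coord_space_def)

lemma image_lin_comb: "lin_comb us ` coord_space (length us) = complex_vector.span (set us)"
proof (rule antisym)
  show "lin_comb us ` coord_space (length us) \<subseteq> complex_vector.span (set us)"
    by (auto simp: lin_comb_def intro!: complex_vector.span_sum complex_vector.span_scale
        complex_vector.span_base[OF nth_mem])
  have "0 \<in> lin_comb us ` coord_space (length us)"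
    using imageI[OF complex_vector.subspace_0[OF subspace_coord_space], of "lin_comb us"]
    by (simp only: lin_comb_zero)
  then have "complex_vector.subspace (lin_comb us ` coord_space (length us))"
    unfolding complex_vector.subspace_def
    using complex_vector.subspace_add[OF subspace_coord_space]
      complex_vector.subspace_scale[OF subspace_coord_space]
    by (auto simp only: lin_comb_add[symmetric] lin_comb_scale[symmetric] imageI)
  moreover have "set us \<subseteq> lin_comb us ` coord_space (length us)"
  proof
    fix u assume "u \<in> set us"
    then obtain c where "c < length us" "u = us ! c" by (auto simp: in_set_conv_nth)
    then show "u \<in> lin_comb us ` coord_space (length us)"
      by (intro image_eqI[of _ _ "basis_vec c"]) (simp_all add: lin_comb_basis_vec basis_vec_in_coord_space)
  qed
  ultimately show "complex_vector.span (set us) \<subseteq> lin_comb us ` coord_space (length us)"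
    by (intro complex_vector.span_minimal)
qed

text \<open>For the list of standard basis vectors \<open>lin_comb\<close> is the identity, so
  \<open>image_lin_comb\<close> exhibits the space as a finite span.\<close>

lemma fin_dim_coord_space: "fin_dim_space (coord_space d)"
proof -
  have "lin_comb (map basis_vec [0..<d]) f = f" if "f \<in> coord_space d" for f
    using that by (auto simp: lin_comb_def fun_eq_iff basis_vec_def coord_space_def if_distrib
        cong: if_cong)
  then have "lin_comb (map basis_vec [0..<d]) ` coord_space d = coord_space d"
    by auto
  then show ?thesis
    using image_lin_comb[of "map basis_vec [0..<d]"] unfolding fin_dim_space_def
    by (metis List.finite_set length_map length_upt minus_nat.diff_0)
qed

text \<open>Each entry of \<open>bs\<close> pairs a representation on coordinates with the vectors
  that its standard basis is sent to. Surjectivity is the spanning hypothesis; injectivity follows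
  from the count against \<open>E\<close>.\<close>

lemma bij_betw_sum_lin_comb:
  fixes bs :: "(('g, nat \<Rightarrow> complex) rep \<times> 'v::complex_vector list) list"
  assumes bs: "\<And>A us. (A, us) \<in> set bs \<Longrightarrow> rspace A = coord_space (length us)"
    and span: "complex_vector.span (set (concat (map snd bs))) = V"
    and E: "complex_vector.independent E" "E \<subseteq> V" "length (concat (map snd bs)) \<le> card E"
  shows "bij_betw (\<lambda>F. \<Sum>i<length bs. lin_comb (snd (bs ! i)) (F i)) (direct_sum_space (map fst bs)) V"
proof -
  define \<phi> where "\<phi> F = (\<Sum>i<length bs. lin_comb (snd (bs ! i)) (F i))" for F
  define D where "D = direct_sum_space (map fst bs)"
  \<comment> \<open>Pairs (block, position) are used instead of the vectors themselves, so that
    \<open>card I\<close> is the total length even if a vector were repeated.\<close>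
  define I where "I = (SIGMA i:{..<length bs}. {..<length (snd (bs ! i))})"
  define b where "b = (\<lambda>(i, c). snd (bs ! i) ! c)"
  have rsp: "rspace (fst (bs ! i)) = coord_space (length (snd (bs ! i)))" if "i < length bs" for i
    using bs[of "fst (bs ! i)" "snd (bs ! i)"] that by simp
  have subD: "complex_vector.subspace D"
    using bs by (force simp: D_def intro!: subspace_direct_sum_space subspace_coord_space)
  have bI: "b ` I = set (concat (map snd bs))"
  proof -
    have "set bs = (!) bs ` {..<length bs}" by (auto simp: set_conv_nth)
    moreover have "b ` I = (\<Union>i<length bs. (!) (snd (bs ! i)) ` {..<length (snd (bs ! i))})"
      by (force simp: b_def I_def)
    moreover have "(!) us ` {..<length us} = set us" for us :: "'v list"
      by (auto simp: set_conv_nth)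
    ultimately show ?thesis by simp
  qed
  have \<phi>_eq: "\<phi> F = (\<Sum>p\<in>I. F (fst p) (snd p) *\<^sub>C b p)" for F
    by (simp add: \<phi>_def lin_comb_def I_def b_def sum.Sigma case_prod_unfold)
  have "finite I" by (simp add: I_def)
  have "card I = length (concat (map snd bs))"
    by (simp add: I_def length_concat sum_list_sum_nth atLeast0LessThan)
  have \<phi>_add: "\<phi> (F + H) = \<phi> F + \<phi> H" and \<phi>_scale: "\<phi> (c *\<^sub>C F) = c *\<^sub>C \<phi> F" for F H c
    by (simp_all add: \<phi>_def lin_comb_add lin_comb_scale sum.distrib complex_vector.scale_sum_right)
  have "inj_on \<phi> D"
  proof
    fix F H assume F: "F \<in> D" and H: "H \<in> D" and "\<phi> F = \<phi> H"
    then have "\<phi> (F - H) = 0" using \<phi>_add[of "F - H" H] by simp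
    then have "(F - H) (fst p) (snd p) = 0" if "p \<in> I" for p
      using E(2,3) span bI \<open>card I = _\<close>
      by (intro spanning_family_independent[OF \<open>finite I\<close> E(1) _ _ _ that]) (simp_all only: \<phi>_eq)
    then have eq: "F i c = H i c" if "i < length bs" "c < length (snd (bs ! i))" for i c
      using that by (force simp: I_def)
    show "F = H"
    proof (intro ext)
      fix i c
      \<comment> \<open>Coordinates not indexed by \<open>I\<close> vanish for both tuples by the
        definition of the direct sum space.\<close>
      consider "i \<ge> length bs" | "i < length bs" "c \<ge> length (snd (bs ! i))"
        | "i < length bs" "c < length (snd (bs ! i))" by linarith
      then show "F i c = H i c"
        using F H by cases (auto simp: eq D_def direct_sum_space_def rsp coord_space_def)
    qed
  qed
  moreover have "\<phi> ` D = V"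
  proof (rule antisym)
    have "\<phi> F \<in> complex_vector.span (b ` I)" for F
      unfolding \<phi>_eq by (intro complex_vector.span_sum complex_vector.span_scale complex_vector.span_base) auto
    then show "\<phi> ` D \<subseteq> V" using span bI by auto
    have "\<phi> 0 = 0" by (simp add: \<phi>_def lin_comb_zero)
    then have "complex_vector.subspace (\<phi> ` D)"
      using complex_vector.subspace_0[OF subD] complex_vector.subspace_add[OF subD]
        complex_vector.subspace_scale[OF subD]
      by (auto simp: complex_vector.subspace_def simp flip: \<phi>_add \<phi>_scale intro: image_eqI[of _ _ 0])
    moreover have "b ` I \<subseteq> \<phi> ` D"
    proof
      fix v assume "v \<in> b ` I"
      then obtain i c where ic: "i < length bs" "c < length (snd (bs ! i))" "v = snd (bs ! i) ! c"
        by (auto simp: I_def b_def)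
      define F where "F = (\<lambda>j. if j = i then basis_vec c else 0 :: nat \<Rightarrow> complex)"
      have "F \<in> D"
        using ic by (auto simp: F_def D_def direct_sum_space_def rsp basis_vec_in_coord_space
            complex_vector.subspace_0[OF subspace_coord_space])
      moreover have "\<phi> F = (\<Sum>j<length bs. if j = i then v else 0)"
        unfolding \<phi>_def F_def using ic
        by (intro sum.cong) (auto simp: lin_comb_zero lin_comb_basis_vec)
      ultimately show "v \<in> \<phi> ` D" using ic by (intro image_eqI[of _ _ F]) auto
    qed
    ultimately show "V \<subseteq> \<phi> ` D"
      using span bI complex_vector.span_minimal by metis
  qed
  ultimately show ?thesis by (simp add: bij_betw_def \<phi>_def[abs_def] D_def)
qed


subsection \<open>The regular representation and its Fourier modes\<close>

lemma residue_in:
  assumes "n > 0"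
  shows "residue n z \<in> {1..int n}"
proof -
  have "0 \<le> (z - 1) mod int n" "(z - 1) mod int n < int n" using assms by simp_all
  then show ?thesis unfolding residue_def atLeastAtMost_iff by linarith
qed

lemma residue_id: "x \<in> {1..int n} \<Longrightarrow> residue n x = x"
  by (simp add: residue_def)

lemma residue_eq_iff: "residue n a = residue n b \<longleftrightarrow> a mod int n = b mod int n"
  by (simp add: residue_def mod_eq_dvd_iff)

lemma residue_mod: "residue n z mod int n = z mod int n"
  by (simp add: residue_def mod_simps)

lemma omega_nonzero [simp]: "\<omega> n \<noteq> 0"
  by (simp add: \<omega>_def)

lemma omega_eq_cis: "\<omega> n = cis (2 * pi / real n)"
  by (simp add: \<omega>_def cis_conv_exp mult_ac)

lemma omega_power: "\<omega> n ^ k = cis (2 * pi * real k / real n)"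
  by (simp add: omega_eq_cis DeMoivre mult_ac)

lemma omega_powi_mod:
  assumes "n > 0"
  shows "\<omega> n powi (a mod int n) = \<omega> n powi a"
proof -
  have "\<omega> n powi int n = 1"
    using assms by (simp add: omega_power)
  then have "\<omega> n powi (int n * (a div int n)) * \<omega> n powi (a mod int n) = \<omega> n powi (a mod int n)"
    by (simp only: power_int_mult) simp
  then show ?thesis by (simp flip: power_int_add)
qed

text \<open>Once the exponent is reduced modulo \<open>n\<close>, this is the distinctness of the
  \<open>n\<close> roots of unity, taken from \<open>bij_betw_roots_unity\<close>.\<close>

lemma omega_powi_eq_1_iff:
  assumes "n > 0"
  shows "\<omega> n powi a = 1 \<longleftrightarrow> int n dvd a"
proof -
  define k where "k = nat (a mod int n)"
  have k: "a mod int n = int k" "k < n"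
    using assms pos_mod_bound[of "int n" a] by (auto simp: k_def nat_less_iff)
  have "inj_on (\<lambda>k. cis (2 * pi * real k / real n)) {..<n}"
    using bij_betw_roots_unity[OF assms] by (rule bij_betw_imp_inj_on)
  then have "\<omega> n ^ k = \<omega> n ^ 0 \<longleftrightarrow> k = 0"
    unfolding omega_power using k assms by (auto dest!: inj_onD[where x = k and y = 0])
  moreover have "\<omega> n powi a = \<omega> n ^ k"
    using omega_powi_mod[OF assms, of a] k by (simp add: power_int_of_nat)
  ultimately show ?thesis using k by (simp add: dvd_eq_mod_eq_0)
qed

lemma omega_powi_eq_iff:
  assumes "n > 0"
  shows "\<omega> n powi a = \<omega> n powi b \<longleftrightarrow> a mod int n = b mod int n"
proof -
  have "\<omega> n powi a = \<omega> n powi b \<longleftrightarrow> \<omega> n powi (a - b) = 1"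
    by (simp add: power_int_diff)
  then show ?thesis by (simp add: omega_powi_eq_1_iff[OF assms] mod_eq_dvd_iff)
qed

section \<open>Reflections acting on functions\<close>

definition zn_space :: "nat \<Rightarrow> (int \<Rightarrow> complex) set" where
  "zn_space n = {f. \<forall>x. x \<notin> {1..int n} \<longrightarrow> f x = 0}"

text \<open>The operator of t in coordinates. The map x -> 2t - x is its own inverse modulo
  \<open>n\<close>, so the image of f has at y the coefficient that f has at 2t - y.\<close>

definition reflect :: "nat \<Rightarrow> int \<Rightarrow> (int \<Rightarrow> complex) \<Rightarrow> int \<Rightarrow> complex" where
  "reflect n t f = (\<lambda>y. if y \<in> {1..int n} then f (residue n (2 * t - y)) else 0)"

lemma reflect_outside: "y \<notin> {1..int n} \<Longrightarrow> reflect n t f y = 0"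
  unfolding reflect_def by (rule if_not_P)

lemma rspace_regular_rep: "rspace (regular_rep (dihedral_quandle n)) = zn_space n"
  by (simp add: regular_rep_def dihedral_quandle_def zn_space_def)

lemma raction_regular_rep:
  assumes "n > 0"
  shows "raction (regular_rep (dihedral_quandle n)) t = restrict (reflect n t) (zn_space n)"
proof -
  have "(\<Sum>x=1..int n. f x *\<^sub>C basis_vec (residue n (2 * t - x))) y = reflect n t f y" for f y
  proof -
    have *: "y = residue n (2 * t - x) \<longleftrightarrow> x = residue n (2 * t - y)"
      if "x \<in> {1..int n}" "y \<in> {1..int n}" for x
    proof -
      have "y = residue n (2 * t - x) \<longleftrightarrow> int n dvd y - (2 * t - x)"
        using that residue_eq_iff[of n y "2 * t - x"] by (simp add: residue_id mod_eq_dvd_iff)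
      also have "y - (2 * t - x) = x - (2 * t - y)" by simp
      also have "int n dvd \<dots> \<longleftrightarrow> x = residue n (2 * t - y)"
        using that residue_eq_iff[of n x "2 * t - y"] by (simp add: residue_id mod_eq_dvd_iff)
      finally show ?thesis .
    qed
    show ?thesis
    proof (cases "y \<in> {1..int n}")
      case True
      have "(\<Sum>x=1..int n. f x *\<^sub>C basis_vec (residue n (2 * t - x))) y =
          (\<Sum>x=1..int n. if x = residue n (2 * t - y) then f x else 0)"
        unfolding sum_fun_apply using * True by (intro sum.cong) (auto simp: basis_vec_def)
      also have "\<dots> = f (residue n (2 * t - y))"
        using residue_in[OF assms] by simp
      finally show ?thesis using True by (simp add: reflect_def)
    next
      case False
      then have "basis_vec (residue n (2 * t - x)) y = 0" for x
        using residue_in[OF assms, of "2 * t - x"] by (auto simp: basis_vec_def)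
      then show ?thesis by (simp add: reflect_outside[OF False])
    qed
  qed
  then have "(\<lambda>f. \<Sum>x=1..int n. f x *\<^sub>C basis_vec (residue n (2 * t - x))) = reflect n t"
    by (intro ext) auto
  then show ?thesis
    by (simp add: regular_rep_def dihedral_quandle_def zn_space_def)
qed

lemma reflect_in_zn_space: "reflect n t f \<in> zn_space n"
  by (auto simp: reflect_def zn_space_def)

lemma reflect_add: "reflect n t (f + g) = reflect n t f + reflect n t g"
  by (auto simp: reflect_def)

lemma reflect_scale: "reflect n t (c *\<^sub>C f) = c *\<^sub>C reflect n t f"
  by (auto simp: reflect_def)

lemma linear_map_on_reflect: "linear_map_on V (reflect n t)"
  by (simp add: linear_map_on_def reflect_add reflect_scale)

lemma subspace_zn_space: "complex_vector.subspace (zn_space n)"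
  by (auto simp: complex_vector.subspace_def zn_space_def)

lemma residue_minus_residue: "residue n (a - residue n b) = residue n (a - b)"
  unfolding residue_eq_iff by (metis mod_diff_right_eq residue_mod)

text \<open>Two reflections compose to a translation of the argument. The involution property, the
  conjugation formula and the order of the product of the generators all rest on this.\<close>

lemma reflect_reflect_apply:
  assumes "n > 0" "y \<in> {1..int n}"
  shows "reflect n s (reflect n t f) y = f (residue n (2 * t - 2 * s + y))"
  using assms residue_in[of n] by (simp add: reflect_def residue_minus_residue algebra_simps)

lemma reflect_reflect:
  assumes "n > 0" "f \<in> zn_space n"
  shows "reflect n t (reflect n t f) = f"
proof
  fix y
  show "reflect n t (reflect n t f) y = f y"
  proof (cases "y \<in> {1..int n}")
    case True
    then show ?thesis using assms(1) by (simp only: reflect_reflect_apply residue_id) (simp add: residue_id)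
  next
    case False
    then show ?thesis using assms(2) by (auto simp: zn_space_def reflect_def)
  qed
qed

lemma reflect_cong: "s mod int n = t mod int n \<Longrightarrow> reflect n s = reflect n t"
proof -
  assume "s mod int n = t mod int n"
  then have "int n dvd s - t" by (simp add: mod_eq_dvd_iff)
  then have "int n dvd 2 * (s - t)" by (rule dvd_mult)
  then have "residue n (2 * s - y) = residue n (2 * t - y)" for y
    by (simp add: residue_eq_iff mod_eq_dvd_iff algebra_simps)
  then show ?thesis by (simp add: reflect_def fun_eq_iff)
qed

text \<open>The defining condition of a quandle representation, with the inverse of the reflection
  at t replaced by that reflection itself.\<close>

lemma reflect_conjugate:
  assumes "n > 0"
  shows "reflect n (2 * t - s) f = reflect n t (reflect n s (reflect n t f))"
proof
  fix y
  show "reflect n (2 * t - s) f y = reflect n t (reflect n s (reflect n t f)) y"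
  proof (cases "y \<in> {1..int n}")
    case True
    have "reflect n t (reflect n s (reflect n t f)) y =
        reflect n t f (residue n (2 * s - 2 * t + y))"
      using assms True by (rule reflect_reflect_apply)
    then show ?thesis using True residue_in[OF assms]
      by (simp add: reflect_def residue_minus_residue algebra_simps)
  qed (simp add: reflect_outside del: atLeastAtMost_iff)
qed

lemma is_quandle_dihedral:
  assumes "n > 0"
  shows "is_quandle (dihedral_quandle n)"
  unfolding is_quandle_def
proof (intro conjI ballI)
  have m: "residue n (2 * a - residue n b) = residue n (2 * a - b)" for a b
    by (rule residue_minus_residue)
  fix x assume "x \<in> qset (dihedral_quandle n)"
  then have x: "x \<in> {1..int n}" by (simp add: dihedral_quandle_def)
  then show "x \<triangleright>\<^bsub>dihedral_quandle n\<^esub> x = x" by (simp add: dihedral_quandle_def residue_id)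
  show "bij_betw (\<lambda>y. y \<triangleright>\<^bsub>dihedral_quandle n\<^esub> x) (qset (dihedral_quandle n)) (qset (dihedral_quandle n))"
    by (rule bij_betwI[where g = "\<lambda>y. y \<triangleright>\<^bsub>dihedral_quandle n\<^esub> x"])
      (use residue_in[OF assms] in \<open>auto simp: dihedral_quandle_def m residue_id\<close>)
  fix y z
  \<comment> \<open>Both sides of the distributive law are 2z - 2y + x modulo \<open>n\<close>. A
    subtracted residue is removed by \<open>residue_minus_residue\<close>; the doubled one is
    treated here.\<close>
  have "int n dvd 2 * (2 * z - y) - (2 * z - x) - (2 * residue n (2 * z - y) - (2 * z - x))"
  proof -
    have "int n dvd (2 * z - y) - residue n (2 * z - y)"
      using residue_mod[of n "2 * z - y"] by (metis mod_eq_dvd_iff)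
    then have "int n dvd 2 * ((2 * z - y) - residue n (2 * z - y))" by (rule dvd_mult)
    then show ?thesis by (simp add: algebra_simps)
  qed
  then have "residue n (2 * (2 * z - y) - (2 * z - x)) = residue n (2 * residue n (2 * z - y) - (2 * z - x))"
    by (simp only: residue_eq_iff mod_eq_dvd_iff)
  then show "(x \<triangleright>\<^bsub>dihedral_quandle n\<^esub> y) \<triangleright>\<^bsub>dihedral_quandle n\<^esub> z =
      (x \<triangleright>\<^bsub>dihedral_quandle n\<^esub> z) \<triangleright>\<^bsub>dihedral_quandle n\<^esub> (y \<triangleright>\<^bsub>dihedral_quandle n\<^esub> z)"
    by (simp add: dihedral_quandle_def residue_minus_residue algebra_simps)
qed

text \<open>Formulated for an invariant subspace so that it serves the whole regular representation
  and every summand alike.\<close>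

lemma quandle_rep_reflect:
  assumes n: "n > 0" and U: "fin_dim_space U" "U \<subseteq> zn_space n"
    and inv: "\<And>t f. f \<in> U \<Longrightarrow> reflect n t f \<in> U"
  shows "quandle_rep (dihedral_quandle n) \<lparr>rspace = U, raction = (\<lambda>t. restrict (reflect n t) U)\<rparr>"
proof -
  have sub: "complex_vector.subspace U" using U(1) by (rule subspace_fin_dim_space)
  interpret group "GL U" by (rule group_GL[OF sub])
  have GL: "restrict (reflect n t) U \<in> carrier (GL U)" for t
    using U n by (intro involution_in_GL sub linear_map_on_reflect inv) (auto intro: reflect_reflect)
  have "inv\<^bsub>GL U\<^esub> (restrict (reflect n t) U) = restrict (reflect n t) U" for t
    using U n inv by (intro inv_GL_involution sub GL) (auto intro: reflect_reflect)
  moreover have "reflect n (residue n (2 * t - s)) = reflect n (2 * t - s)" for s t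
    by (rule reflect_cong) (rule residue_mod)
  ultimately have "restrict (reflect n (s \<triangleright>\<^bsub>dihedral_quandle n\<^esub> t)) U =
      restrict (reflect n t) U \<otimes>\<^bsub>GL U\<^esub> restrict (reflect n s) U
        \<otimes>\<^bsub>GL U\<^esub> inv\<^bsub>GL U\<^esub> (restrict (reflect n t) U)" for s t
    by (intro GL_eqI[of _ U])
      (simp_all add: GL GL_mult_apply inv dihedral_quandle_def reflect_conjugate[OF n])
  then show ?thesis
    using U GL is_quandle_dihedral[OF n] by (simp add: quandle_rep_def)
qed

section \<open>Fourier modes and Fourier inversion\<close>

definition mode :: "nat \<Rightarrow> int \<Rightarrow> int \<Rightarrow> complex" where
  "mode n j = (\<lambda>y. if y \<in> {1..int n} then \<omega> n powi (j * y) else 0)"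

lemma mode_in_zn_space: "mode n j \<in> zn_space n"
  by (auto simp: mode_def zn_space_def)

lemma mode_cong:
  assumes "n > 0" "i mod int n = j mod int n"
  shows "mode n i = mode n j"
proof -
  have "(i * y) mod int n = (j * y) mod int n" for y
    using assms(2) by (metis mod_mult_left_eq)
  then show ?thesis
    using omega_powi_eq_iff[OF assms(1)] by (simp add: mode_def fun_eq_iff)
qed

lemma reflect_mode:
  assumes "n > 0"
  shows "reflect n t (mode n j) = \<omega> n powi (2 * t * j) *\<^sub>C mode n (- j)"
proof
  fix y
  have "(j * residue n (2 * t - y)) mod int n = (2 * t * j + (- j) * y) mod int n"
    using mod_mult_right_eq[of j "residue n (2 * t - y)" "int n"] mod_mult_right_eq[of j "2 * t - y" "int n"]
    by (simp add: residue_mod algebra_simps)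
  then have "\<omega> n powi (j * residue n (2 * t - y)) = \<omega> n powi (2 * t * j + (- j) * y)"
    using omega_powi_eq_iff[OF assms] by blast
  also have "\<dots> = \<omega> n powi (2 * t * j) * \<omega> n powi ((- j) * y)"
    by (rule power_int_add) simp
  finally show "reflect n t (mode n j) y = (\<omega> n powi (2 * t * j) *\<^sub>C mode n (- j)) y"
    using residue_in[OF assms, of "2 * t - y"] by (simp add: reflect_def mode_def)
qed

text \<open>A geometric series whose ratio is an \<open>n\<close>-th root of unity, equal to 1
  exactly when \<open>n\<close> divides d: the orthogonality relation behind Fourier
  inversion.\<close>

lemma sum_omega_powi:
  assumes "n > 0"
  shows "(\<Sum>j<n. \<omega> n powi (int j * d)) = (if int n dvd d then of_nat n else 0)"
proof -
  have eq: "\<omega> n powi (int j * d) = (\<omega> n powi d) ^ j" for j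
    by (metis mult.commute power_int_mult power_int_of_nat)
  show ?thesis
  proof (cases "int n dvd d")
    case True
    then have "\<omega> n powi d = 1" using omega_powi_eq_1_iff[OF assms] by blast
    then show ?thesis using True by (simp add: eq)
  next
    case False
    then have "\<omega> n powi d \<noteq> 1" using omega_powi_eq_1_iff[OF assms] by blast
    moreover have "(\<omega> n powi d) ^ n = 1"
      using omega_powi_eq_1_iff[OF assms, of "int n * d"] eq[of n] by simp
    ultimately show ?thesis using False by (simp add: eq geometric_sum)
  qed
qed

text \<open>The inverse discrete Fourier transform. Orthogonality leaves the y congruent to x, and
  within {1..n} congruent means equal.\<close>

lemma basis_vec_eq_sum_mode:
  assumes "n > 0" "x \<in> {1..int n}"
  shows "basis_vec x = (\<Sum>j<n. (\<omega> n powi (- (int j * x)) / of_nat n) *\<^sub>C mode n (int j))"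
proof
  fix y
  show "basis_vec x y = (\<Sum>j<n. (\<omega> n powi (- (int j * x)) / of_nat n) *\<^sub>C mode n (int j)) y"
  proof (cases "y \<in> {1..int n}")
    case True
    have "(\<Sum>j<n. (\<omega> n powi (- (int j * x)) / of_nat n) *\<^sub>C mode n (int j)) y =
        (\<Sum>j<n. \<omega> n powi (int j * (y - x)) / of_nat n)"
      using True by (simp add: mode_def power_int_add[symmetric] algebra_simps
          power_int_diff power_int_minus divide_simps)
    also have "\<dots> = (if int n dvd y - x then 1 else 0)"
      using assms(1) by (simp add: sum_omega_powi flip: sum_divide_distrib)
    also have "int n dvd y - x \<longleftrightarrow> y = x"
      using residue_eq_iff[of n y x] True assms(2) by (simp add: residue_id mod_eq_dvd_iff)
    finally show ?thesis by (simp add: basis_vec_def)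
  next
    case False
    with assms(2) show ?thesis by (auto simp: basis_vec_def mode_def)
  qed
qed

lemma span_basis_vec: "complex_vector.span (basis_vec ` {1..int n}) = zn_space n"
proof (rule antisym)
  show "complex_vector.span (basis_vec ` {1..int n}) \<subseteq> zn_space n"
    by (rule complex_vector.span_minimal) (auto simp: subspace_zn_space, auto simp: zn_space_def basis_vec_def)
  show "zn_space n \<subseteq> complex_vector.span (basis_vec ` {1..int n})"
  proof
    fix f assume "f \<in> zn_space n"
    then have "f = (\<Sum>x=1..int n. f x *\<^sub>C basis_vec x)"
      by (auto simp: fun_eq_iff basis_vec_def zn_space_def if_distrib cong: if_cong)
    also have "\<dots> \<in> complex_vector.span (basis_vec ` {1..int n})"
      by (intro complex_vector.span_sum complex_vector.span_scale complex_vector.span_base imageI)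
    finally show "f \<in> complex_vector.span (basis_vec ` {1..int n})" .
  qed
qed

lemma fin_dim_zn_space: "fin_dim_space (zn_space n)"
  unfolding fin_dim_space_def by (intro exI[of _ "basis_vec ` {1..int n}"]) (simp add: span_basis_vec)

lemma inj_basis_vec: "inj basis_vec"
proof (rule injI)
  fix x y :: 'a assume "basis_vec x = basis_vec y"
  then have "basis_vec x x = basis_vec y x" by simp
  then show "x = y" by (simp add: basis_vec_def split: if_splits)
qed

lemma independent_basis_vec:
  assumes "finite I"
  shows "complex_vector.independent (basis_vec ` I)"
proof -
  have inj: "inj_on basis_vec I" using inj_basis_vec by (rule inj_on_subset) simp
  have *: "u x = 0" if "x \<in> I" "(\<Sum>x\<in>I. u x *\<^sub>C basis_vec x) = 0" for u x
  proof -
    have "(\<Sum>z\<in>I. u z *\<^sub>C basis_vec z) x = (\<Sum>z\<in>I. if z = x then u z else 0)"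
      unfolding sum_fun_apply by (intro sum.cong) (auto simp: basis_vec_def)
    with that assms show ?thesis by simp
  qed
  show ?thesis
  proof
    assume "complex_vector.dependent (basis_vec ` I)"
    then obtain u where "\<exists>x\<in>I. u (basis_vec x) \<noteq> 0" "(\<Sum>x\<in>I. u (basis_vec x) *\<^sub>C basis_vec x) = 0"
      using assms by (auto simp: complex_vector.dependent_finite sum.reindex[OF inj])
    then show False using *[of _ "\<lambda>x. u (basis_vec x)"] by blast
  qed
qed

section \<open>The regular representation and its subrepresentations in terms of reflections\<close>

lemma regular_rep_eq:
  "n > 0 \<Longrightarrow> regular_rep (dihedral_quandle n) =
     \<lparr>rspace = zn_space n, raction = (\<lambda>t. restrict (reflect n t) (zn_space n))\<rparr>"
  by (rule rep.equality) (simp_all add: rspace_regular_rep ext[OF raction_regular_rep])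

lemma subrep_on_regular_rep:
  assumes "n > 0" "U \<subseteq> zn_space n"
  shows "subrep_on (regular_rep (dihedral_quandle n)) U =
     \<lparr>rspace = U, raction = (\<lambda>t. restrict (reflect n t) U)\<rparr>"
proof -
  have "restrict (restrict (reflect n t) (zn_space n)) U = restrict (reflect n t) U" for t
    using assms(2) by (simp add: Int_absorb1)
  then show ?thesis using assms(1) by (simp add: subrep_on_def regular_rep_eq)
qed

text \<open>Restrictions and the range of t disappear from the condition: every integer t has the
  same reflection as its residue, which lies in the quandle.\<close>

lemma quandle_subrep_iff:
  assumes "n > 0" "U \<subseteq> zn_space n"
  shows "quandle_subrep (dihedral_quandle n)
      \<lparr>rspace = U, raction = (\<lambda>t. restrict (reflect n t) U)\<rparr> W \<longleftrightarrow>
    complex_vector.subspace W \<and> W \<subseteq> U \<and> (\<forall>t. \<forall>f\<in>W. reflect n t f \<in> W)"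
proof -
  have "reflect n (residue n t) = reflect n t" for t
    by (rule reflect_cong) (rule residue_mod)
  then have *: "(\<forall>t\<in>{1..int n}. \<forall>f\<in>W. reflect n t f \<in> W) \<longleftrightarrow> (\<forall>t. \<forall>f\<in>W. reflect n t f \<in> W)"
    by (metis residue_in[OF assms(1)])
  show ?thesis
  proof (cases "W \<subseteq> U")
    case True
    have "restrict (reflect n t) U ` W \<subseteq> W \<longleftrightarrow> (\<forall>f\<in>W. reflect n t f \<in> W)" for t
      using subsetD[OF True] by (simp add: image_subset_iff)
    then show ?thesis
      using * by (simp add: quandle_subrep_def dihedral_quandle_def del: atLeastAtMost_iff)
  next
    case False
    then show ?thesis by (simp add: quandle_subrep_def)
  qed
qed


subsection \<open>Assembling irreducible blocks\<close>

text \<open>The product of the two generators translates the argument by 2, so its power relation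
  amounts to \<open>n\<close> dividing twice \<open>dihedral_index n\<close>. For even
  \<open>n\<close> this is an equality.\<close>

lemma dihedral_action_regular_rep:
  assumes "n > 0"
  shows "dihedral_action (dihedral_index n) (zn_space n)
    (restrict (reflect n 1) (zn_space n)) (restrict (reflect n 2) (zn_space n))"
proof
  have inv: "restrict (reflect n t) (zn_space n) (restrict (reflect n t) (zn_space n) f) = f"
    if "f \<in> zn_space n" for t f
    using that assms by (simp add: reflect_in_zn_space reflect_reflect)
  show "restrict (reflect n 1) (zn_space n) (restrict (reflect n 1) (zn_space n) f) = f"
    "restrict (reflect n 2) (zn_space n) (restrict (reflect n 2) (zn_space n) f) = f"
    if "f \<in> zn_space n" for f
    using that by (rule inv)+
  have "restrict (reflect n t) (zn_space n) \<in> carrier (GL (zn_space n))" for t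
    by (intro involution_in_GL reflect_in_zn_space reflect_reflect assms linear_map_on_reflect
        subspace_zn_space)
  then show "restrict (reflect n 1) (zn_space n) \<in> carrier (GL (zn_space n))"
    "restrict (reflect n 2) (zn_space n) \<in> carrier (GL (zn_space n))"
    by this+
  show "fin_dim_space (zn_space n)" by (rule fin_dim_zn_space)
  fix f assume f: "f \<in> zn_space n"
  define T where "T f = restrict (reflect n 1) (zn_space n) (restrict (reflect n 2) (zn_space n) f)" for f
  have T: "T g = reflect n 1 (reflect n 2 g)" if "g \<in> zn_space n" for g
    using that by (simp add: T_def reflect_in_zn_space)
  have pow_in: "(T ^^ k) f \<in> zn_space n" for k
    using f by (induction k) (simp_all add: T reflect_in_zn_space)
  have pow: "(T ^^ k) f y = f (residue n (y + 2 * int k))" if "y \<in> {1..int n}" for k y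
    using that
  proof (induction k arbitrary: y)
    case 0
    then show ?case by (simp only: residue_id funpow_0 of_nat_0 mult_zero_right add_0_right)
  next
    case (Suc k)
    have "residue n (residue n (2 + y) + 2 * int k) = residue n (y + 2 * int (Suc k))"
      unfolding residue_eq_iff using mod_add_left_eq[of "residue n (2 + y)" "int n" "2 * int k"]
        mod_add_left_eq[of "2 + y" "int n" "2 * int k"]
      by (simp add: residue_mod algebra_simps)
    then show ?case
      using Suc.IH[OF residue_in[OF assms, of "2 + y"]]
      by (simp add: T[OF pow_in] reflect_reflect_apply[OF assms Suc.prems] del: of_nat_Suc)
  qed
  have "(T ^^ dihedral_index n) f = f"
  proof
    fix y
    show "(T ^^ dihedral_index n) f y = f y"
    proof (cases "y \<in> {1..int n}")
      case True
      have "int n dvd 2 * int (dihedral_index n)"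
        by (auto simp: dihedral_index_def)
      then have "residue n (y + 2 * int (dihedral_index n)) = residue n y"
        by (simp add: residue_eq_iff mod_eq_dvd_iff)
      then show ?thesis using pow[OF True] residue_id[OF True] by simp
    next
      case False
      then show ?thesis using f pow_in[of "dihedral_index n"] by (simp add: zn_space_def del: atLeastAtMost_iff)
    qed
  qed
  then show "((\<lambda>f. restrict (reflect n 1) (zn_space n) (restrict (reflect n 2) (zn_space n) f))
      ^^ dihedral_index n) f = f"
    by (simp only: T_def[abs_def])
qed

lemma regular_rep_dihedral_eq:
  assumes "n > 0"
  shows "regular_rep_dihedral n = \<lparr>rspace = zn_space n, raction = induced_hom (GL (zn_space n))
    (gen_map (restrict (reflect n 1) (zn_space n)) (restrict (reflect n 2) (zn_space n)))\<rparr>"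
proof -
  have "reflect n (residue n t) = reflect n t" for t
    by (rule reflect_cong) (rule residue_mod)
  then show ?thesis
    by (simp add: regular_rep_dihedral_def rspace_regular_rep raction_regular_rep[OF assms])
qed

text \<open>
  Here \<open>t\<close> ranges over all integers; the reflections at \<open>t\<close> and at \<open>residue n t\<close> agree.
\<close>

definition irreducible_block ::
  "nat \<Rightarrow> (dgen word set, nat \<Rightarrow> complex) rep \<Rightarrow> (int \<Rightarrow> complex) list \<Rightarrow> bool" where
  "irreducible_block n A us \<longleftrightarrow>
     (\<exists>a b. dihedral_action (dihedral_index n) (coord_space (length us)) a b \<and>
        A = \<lparr>rspace = coord_space (length us),
             raction = induced_hom (GL (coord_space (length us))) (gen_map a b)\<rparr> \<and>
        (\<forall>f\<in>coord_space (length us).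
           lin_comb us (a f) = reflect n 1 (lin_comb us f) \<and>
           lin_comb us (b f) = reflect n 2 (lin_comb us f))) \<and>
     set us \<subseteq> zn_space n \<and>
     (\<forall>t. \<forall>f\<in>complex_vector.span (set us). reflect n t f \<in> complex_vector.span (set us)) \<and>
     complex_vector.span (set us) \<noteq> {0} \<and>
     (\<forall>W. complex_vector.subspace W \<and> W \<subseteq> complex_vector.span (set us) \<and>
        (\<forall>t. \<forall>f\<in>W. reflect n t f \<in> W) \<longrightarrow> W = {0} \<or> W = complex_vector.span (set us))"

lemma irreducible_blockE:
  assumes "irreducible_block n A us"
  obtains a b where "dihedral_action (dihedral_index n) (coord_space (length us)) a b"
    and "A = \<lparr>rspace = coord_space (length us),
      raction = induced_hom (GL (coord_space (length us))) (gen_map a b)\<rparr>"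
    and "\<And>f. f \<in> coord_space (length us) \<Longrightarrow> lin_comb us (a f) = reflect n 1 (lin_comb us f)"
    and "\<And>f. f \<in> coord_space (length us) \<Longrightarrow> lin_comb us (b f) = reflect n 2 (lin_comb us f)"
  using assms unfolding irreducible_block_def
  apply (elim conjE exE)
  subgoal premises prems for a b
    by (rule prems(1)[OF prems(6,7)]) (use prems(8) in simp_all)
  done

text \<open>Modes depend on the index modulo \<open>n\<close>, so an index above n/2 is the negative
  of one below it. By Fourier inversion all modes together yield the standard basis.\<close>

lemma span_modes:
  assumes n: "n > 0" and S: "complex_vector.subspace S"
    and modes: "\<And>j. 0 \<le> j \<Longrightarrow> 2 * j \<le> int n \<Longrightarrow> mode n j \<in> S \<and> mode n (- j) \<in> S"
  shows "zn_space n \<subseteq> S"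
proof -
  have mode: "mode n (int j) \<in> S" if "j < n" for j
  proof (cases "2 * j \<le> n")
    case True
    then show ?thesis using modes[of "int j"] by simp
  next
    case False
    have "mode n (int j) = mode n (- (int n - int j))"
      by (rule mode_cong[OF n]) (simp add: mod_eq_dvd_iff)
    then show ?thesis using modes[of "int n - int j"] that False by simp
  qed
  have "basis_vec x \<in> S" if "x \<in> {1..int n}" for x
    unfolding basis_vec_eq_sum_mode[OF n that]
    by (intro complex_vector.subspace_sum[OF S] complex_vector.subspace_scale[OF S] mode) simp
  then have "complex_vector.span (basis_vec ` {1..int n}) \<subseteq> S"
    by (intro complex_vector.span_minimal[OF _ S]) auto
  then show ?thesis by (simp add: span_basis_vec)
qed

text \<open>The common criterion for the three cases. What remains for each is to list blocks of
  total length \<open>n\<close> that reach all modes; directness of the sum is then a matter of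
  counting.\<close>

lemma irreducible_decompositionI:
  assumes n: "n > 0"
    and blocks: "\<And>A us. (A, us) \<in> set bs \<Longrightarrow> irreducible_block n A us"
    and len: "length (concat (map snd bs)) = n"
    and modes: "\<And>j. 0 \<le> j \<Longrightarrow> 2 * j \<le> int n \<Longrightarrow>
      mode n j \<in> complex_vector.span (set (concat (map snd bs))) \<and>
      mode n (- j) \<in> complex_vector.span (set (concat (map snd bs)))"
  shows "irreducible_decomposition n (map fst bs)"
proof -
  define L where "L = map fst bs"
  define V where "V = zn_space n"
  define S where "S = complex_vector.span (set (concat (map snd bs)))"
  define \<phi> where "\<phi> F = (\<Sum>i<length bs. lin_comb (snd (bs ! i)) (F i))" for F
  define m where "m = dihedral_index n"
  let ?B = "regular_rep_dihedral n"
  note subV = subspace_zn_space[of n, folded V_def]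
  have len_L: "length L = length bs" by (simp add: L_def)
  have block: "irreducible_block n (L ! i) (snd (bs ! i))" if "i < length bs" for i
    using blocks[of "fst (bs ! i)" "snd (bs ! i)"] that by (simp add: L_def)
  have rsp: "rspace A = coord_space (length us)" if "(A, us) \<in> set bs" for A us
    using blocks[OF that] by (auto simp: irreducible_block_def)
  have rsp_i: "rspace (L ! i) = coord_space (length (snd (bs ! i)))" if "i < length bs" for i
    using block[OF that] by (auto simp: irreducible_block_def)
  have us: "set (snd (bs ! i)) \<subseteq> V" if "i < length bs" for i
    using block[OF that] by (simp add: irreducible_block_def V_def)
  then have spanV: "complex_vector.span (set (snd (bs ! i))) \<subseteq> V" if "i < length bs" for i
    using that by (intro complex_vector.span_minimal subV) auto
  have lc: "lin_comb (snd (bs ! i)) f \<in> complex_vector.span (set (snd (bs ! i)))"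
    if "i < length bs" "f \<in> rspace (L ! i)" for i f
    using that rsp_i image_lin_comb[of "snd (bs ! i)"] by auto

  have "S = V"
  proof (rule antisym)
    have "set us \<subseteq> V" if "(A, us) \<in> set bs" for A us
      using blocks[OF that] by (simp add: irreducible_block_def V_def)
    then show "S \<subseteq> V" unfolding S_def
      by (intro complex_vector.span_minimal subV) fastforce
    show "V \<subseteq> S" unfolding S_def V_def
      using modes by (intro span_modes[OF n]) auto
  qed
  have bij: "bij_betw \<phi> (direct_sum_space L) V"
    unfolding \<phi>_def[abs_def] L_def
  proof (rule bij_betw_sum_lin_comb[OF rsp])
    show "complex_vector.span (set (concat (map snd bs))) = V" using \<open>S = V\<close> by (simp add: S_def)
    \<comment> \<open>The standard basis supplies the \<open>n\<close> independent vectors against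
      which the block vectors are counted.\<close>
    show "complex_vector.independent (basis_vec ` {1..int n})" by (rule independent_basis_vec) simp
    show "basis_vec ` {1..int n} \<subseteq> V"
      unfolding V_def using span_basis_vec complex_vector.span_superset by metis
    show "length (concat (map snd bs)) \<le> card (basis_vec ` {1..int n})"
      using len by (simp add: card_image[OF inj_on_subset[OF inj_basis_vec subset_UNIV]])
  qed

  interpret B: dihedral_action m V "restrict (reflect n 1) V" "restrict (reflect n 2) V"
    unfolding m_def V_def using n by (rule dihedral_action_regular_rep)
  have B: "?B = B.rep" unfolding V_def using n by (rule regular_rep_dihedral_eq)
  have "group (dihedral m)" by (simp add: dihedral_def group_presented_group)
  moreover have grp: "group_rep (dihedral m) A" if A: "A \<in> set L" for A
  proof -
    obtain us where "(A, us) \<in> set bs" using A by (auto simp: L_def)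
    from blocks[OF this] show ?thesis
      by (rule irreducible_blockE) (simp add: dihedral_action.group_rep m_def)
  qed
  ultimately have direct: "group_rep (dihedral m) (direct_sum L)"
    by (rule group_rep_direct_sum)
  have inter: "lin_comb (snd (bs ! i)) (raction (L ! i) g f) = raction ?B g (lin_comb (snd (bs ! i)) f)"
    if i: "i < length bs" and g: "g \<in> carrier (dihedral m)" and f: "f \<in> rspace (L ! i)" for i g f
  proof -
    let ?us = "snd (bs ! i)" and ?W = "coord_space (length (snd (bs ! i)))"
    obtain a b where ab: "dihedral_action m ?W a b"
      "L ! i = \<lparr>rspace = ?W, raction = induced_hom (GL ?W) (gen_map a b)\<rparr>"
      and a: "\<And>f. f \<in> ?W \<Longrightarrow> lin_comb ?us (a f) = reflect n 1 (lin_comb ?us f)"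
      and b: "\<And>f. f \<in> ?W \<Longrightarrow> lin_comb ?us (b f) = reflect n 2 (lin_comb ?us f)"
      using irreducible_blockE[OF block[OF i], folded m_def] by metis
    have mem: "lin_comb ?us f \<in> V" if "f \<in> ?W" for f
      using that lc[OF i] spanV[OF i] rsp_i[OF i] by auto
    show ?thesis
      unfolding B ab(2) rep.simps
      by (rule dihedral_intertwining[OF ab(1) B.dihedral_action_axioms])
        (use a b mem f g rsp_i[OF i] in simp_all)
  qed
  have "rep_iso (dihedral m) (direct_sum L) ?B \<phi>"
    unfolding rep_iso_def
  proof (intro conjI ballI direct)
    show "group_rep (dihedral m) ?B" unfolding B by (rule B.group_rep)
    show "linear_map_on (rspace (direct_sum L)) \<phi>"
      by (simp add: linear_map_on_def \<phi>_def lin_comb_add lin_comb_scale sum.distrib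
          complex_vector.scale_sum_right)
    show "bij_betw \<phi> (rspace (direct_sum L)) (rspace ?B)"
      using bij by (simp add: direct_sum_def B)
    fix g F assume g: "g \<in> carrier (dihedral m)" and "F \<in> rspace (direct_sum L)"
    then have F: "F \<in> direct_sum_space L" by (simp add: direct_sum_def)
    have Fi: "F i \<in> rspace (L ! i)" if "i < length bs" for i
      using F that by (simp add: direct_sum_space_def len_L)
    have "\<phi> (raction (direct_sum L) g F) = (\<Sum>i<length bs. raction ?B g (lin_comb (snd (bs ! i)) (F i)))"
      using F Fi inter[OF _ g] by (simp add: \<phi>_def direct_sum_def len_L)
    also have "\<dots> = raction ?B g (\<phi> F)"
      unfolding \<phi>_def
    proof (rule linear_map_on_sum[symmetric, OF subV])
      show "linear_map_on V (raction ?B g)"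
        using GL_linear[OF group_rep_in_GL[OF B.group_rep g]] by (simp add: B)
      show "lin_comb (snd (bs ! i)) (F i) \<in> V" if "i \<in> {..<length bs}" for i
        using that lc[OF _ Fi] spanV by auto
    qed
    finally show "\<phi> (raction (direct_sum L) g F) = raction ?B g (\<phi> F)" .
  qed
  moreover have "quandle_subrep (dihedral_quandle n) (regular_rep (dihedral_quandle n)) (\<phi> ` nth_summand L i) \<and>
      quandle_irreducible (dihedral_quandle n)
        (subrep_on (regular_rep (dihedral_quandle n)) (\<phi> ` nth_summand L i))"
    if "i < length L" for i
  proof -
    let ?us = "snd (bs ! i)"
    let ?U = "complex_vector.span (set ?us)"
    have i: "i < length bs" using that by (simp add: len_L)
    note blk = block[OF i, unfolded irreducible_block_def]
    \<comment> \<open>On one summand a single term of \<open>\<phi>\<close> survives, so its image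
      is the span of the vectors of that block.\<close>
    have single: "\<phi> F = lin_comb ?us (F i)" if "F \<in> nth_summand L i" for F
    proof -
      have "\<phi> F = (\<Sum>j<length bs. if j = i then lin_comb ?us (F i) else 0)"
        unfolding \<phi>_def using that by (intro sum.cong) (auto simp: nth_summand_def lin_comb_zero)
      then show ?thesis using i by simp
    qed
    have "\<phi> ` nth_summand L i = lin_comb ?us ` coord_space (length ?us)"
    proof (rule antisym)
      show "\<phi> ` nth_summand L i \<subseteq> lin_comb ?us ` coord_space (length ?us)"
        using i by (auto simp: single nth_summand_def direct_sum_space_def len_L rsp_i)
      show "lin_comb ?us ` coord_space (length ?us) \<subseteq> \<phi> ` nth_summand L i"
      proof
        fix v assume "v \<in> lin_comb ?us ` coord_space (length ?us)"
        then obtain f where f: "f \<in> coord_space (length ?us)" "v = lin_comb ?us f" by auto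
        define F where "F = (\<lambda>j. if j = i then f else 0)"
        have "F \<in> nth_summand L i"
          using f i complex_vector.subspace_0[OF subspace_coord_space]
          by (auto simp: F_def nth_summand_def direct_sum_space_def len_L rsp_i)
        then show "v \<in> \<phi> ` nth_summand L i"
          using single f by (intro image_eqI[of _ _ F]) (auto simp: F_def)
      qed
    qed
    then have img: "\<phi> ` nth_summand L i = ?U" by (simp add: image_lin_comb)
    have U: "?U \<subseteq> zn_space n" using spanV[OF i] by (simp add: V_def)
    have "fin_dim_space ?U" unfolding fin_dim_space_def by (intro exI[of _ "set ?us"]) simp
    moreover have inv: "\<And>t f. f \<in> ?U \<Longrightarrow> reflect n t f \<in> ?U" using blk by blast
    ultimately have "quandle_irreducible (dihedral_quandle n) \<lparr>rspace = ?U, raction = \<lambda>t. restrict (reflect n t) ?U\<rparr>"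
      using blk unfolding quandle_irreducible_def quandle_subrep_iff[OF n U]
      by (auto intro!: quandle_rep_reflect[OF n _ U])
    moreover have "quandle_subrep (dihedral_quandle n) (regular_rep (dihedral_quandle n)) ?U"
      unfolding regular_rep_eq[OF n] quandle_subrep_iff[OF n subset_refl] using U inv by auto
    ultimately show ?thesis by (simp add: img subrep_on_regular_rep[OF n U])
  qed
  moreover have "quandle_rep (dihedral_quandle n) (regular_rep (dihedral_quandle n))"
    unfolding regular_rep_eq[OF n]
    by (intro quandle_rep_reflect n fin_dim_zn_space reflect_in_zn_space subset_refl)
  ultimately show ?thesis
    unfolding irreducible_decomposition_def Let_def L_def m_def by blast
qed


subsection \<open>The irreducible blocks\<close>

lemma matrix_op_1:
  "f \<in> coord_space 1 \<Longrightarrow> matrix_op 1 [[a]] f = a *\<^sub>C f"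
  by (auto simp: matrix_op_def coord_space_def fun_eq_iff)

lemma matrix_op_antidiagonal:
  "f \<in> coord_space 2 \<Longrightarrow>
     matrix_op 2 [[0, a], [b, 0]] f = (\<lambda>i. if i = 0 then a * f 1 else if i = 1 then b * f 0 else 0)"
  by (auto simp: matrix_op_def coord_space_def fun_eq_iff numeral_2_eq_2 less_Suc_eq)

lemma dihedral_action_char_rep:
  assumes "a\<^sup>2 = 1" "b\<^sup>2 = 1" "(a * b) ^ m = 1"
  shows "dihedral_action m (coord_space 1) (matrix_op 1 [[a]]) (matrix_op 1 [[b]])"
proof
  have scale: "c *\<^sub>C f \<in> coord_space 1" if "f \<in> coord_space 1" for c f
    using complex_vector.subspace_scale[OF subspace_coord_space] that by blast
  have invol: "matrix_op 1 [[c]] (matrix_op 1 [[c]] f) = f" if "f \<in> coord_space 1" "c\<^sup>2 = 1" for c f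
    using that by (simp add: matrix_op_1 scale scaleC_one del: One_nat_def flip: power2_eq_square)
  have "matrix_op 1 [[c]] \<in> carrier (GL (coord_space 1))" if "c\<^sup>2 = 1" for c
  proof -
    have "restrict (matrix_op 1 [[c]]) (coord_space 1) \<in> carrier (GL (coord_space 1))"
      by (intro involution_in_GL invol subspace_coord_space that)
        (auto simp: matrix_op_1 scale linear_map_on_def scaleC_add_right scaleC_scaleC mult.commute
          complex_vector.subspace_add[OF subspace_coord_space] simp del: One_nat_def)
    then show ?thesis by (simp add: matrix_op_def)
  qed
  then show "matrix_op 1 [[a]] \<in> carrier (GL (coord_space 1))"
    "matrix_op 1 [[b]] \<in> carrier (GL (coord_space 1))" using assms by auto
  show "fin_dim_space (coord_space 1)" by (rule fin_dim_coord_space)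
  fix f assume f: "f \<in> coord_space 1"
  show "matrix_op 1 [[a]] (matrix_op 1 [[a]] f) = f" "matrix_op 1 [[b]] (matrix_op 1 [[b]] f) = f"
    by (rule invol[OF f assms(1)] invol[OF f assms(2)])+
  have "((\<lambda>v. matrix_op 1 [[a]] (matrix_op 1 [[b]] v)) ^^ k) f = (a * b) ^ k *\<^sub>C f" for k
    by (induction k) (simp_all add: f matrix_op_1 scale scaleC_one mult_ac del: One_nat_def scaleC_fun_apply)
  then show "((\<lambda>v. matrix_op 1 [[a]] (matrix_op 1 [[b]] v)) ^^ m) f = f"
    using assms(3) by (simp add: scaleC_one)
qed

text \<open>The product of the two matrices is diagonal with entries \<open>inverse z\<close> and
  \<open>z\<close>, so the power relation becomes \<open>z ^ m = 1\<close>.\<close>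

lemma dihedral_action_W_rep:
  assumes "z \<noteq> 0" "z ^ m = 1"
  shows "dihedral_action m (coord_space 2) (matrix_op 2 [[0, 1], [1, 0]]) (matrix_op 2 [[0, z], [inverse z, 0]])"
proof
  have closed: "matrix_op 2 [[0, c], [d, 0]] f \<in> coord_space 2" if "f \<in> coord_space 2" for c d f
    using that by (subst matrix_op_antidiagonal) (auto simp: coord_space_def)
  have invol: "matrix_op 2 [[0, c], [inverse c, 0]] (matrix_op 2 [[0, c], [inverse c, 0]] f) = f"
    if "f \<in> coord_space 2" "c \<noteq> 0" for c f
    unfolding matrix_op_antidiagonal[OF closed[OF that(1)]] unfolding matrix_op_antidiagonal[OF that(1)]
    using that by (auto simp: coord_space_def fun_eq_iff numeral_2_eq_2 not_less_eq_eq less_Suc_eq_le)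
  have GL: "matrix_op 2 [[0, c], [inverse c, 0]] \<in> carrier (GL (coord_space 2))" if "c \<noteq> 0" for c
  proof -
    have "linear_map_on (coord_space 2) (matrix_op 2 [[0, c], [inverse c, 0]])"
      by (auto simp: linear_map_on_def matrix_op_antidiagonal fun_eq_iff algebra_simps
          complex_vector.subspace_add[OF subspace_coord_space]
          complex_vector.subspace_scale[OF subspace_coord_space])
    then have "restrict (matrix_op 2 [[0, c], [inverse c, 0]]) (coord_space 2) \<in> carrier (GL (coord_space 2))"
      by (intro involution_in_GL invol subspace_coord_space that closed)
    then show ?thesis by (simp add: matrix_op_def)
  qed
  show "matrix_op 2 [[0, 1], [1, 0]] \<in> carrier (GL (coord_space 2))"
    using GL[of 1] by simp
  show "matrix_op 2 [[0, z], [inverse z, 0]] \<in> carrier (GL (coord_space 2))"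
    using GL assms(1) by simp
  show "fin_dim_space (coord_space 2)" by (rule fin_dim_coord_space)
  fix f assume f: "f \<in> coord_space 2"
  show "matrix_op 2 [[0, 1], [1, 0]] (matrix_op 2 [[0, 1], [1, 0]] f) = f"
    using invol[OF f, of 1] by simp
  show "matrix_op 2 [[0, z], [inverse z, 0]] (matrix_op 2 [[0, z], [inverse z, 0]] f) = f"
    using f assms(1) by (rule invol)
  define T where "T = (\<lambda>v. matrix_op 2 [[0, 1], [1, 0]] (matrix_op 2 [[0, z], [inverse z, 0]] v))"
  have T: "T g = (\<lambda>i. if i = 0 then inverse z * g 0 else if i = 1 then z * g 1 else 0)"
    if "g \<in> coord_space 2" for g
    unfolding T_def matrix_op_antidiagonal[OF closed[OF that]] unfolding matrix_op_antidiagonal[OF that]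
    by (auto simp: fun_eq_iff)
  have "(T ^^ k) f = (\<lambda>i. if i = 0 then inverse z ^ k * f 0 else if i = 1 then z ^ k * f 1 else 0)" for k
  proof (induction k)
    case 0
    show ?case using f
      by (auto simp: coord_space_def fun_eq_iff numeral_2_eq_2 not_less_eq_eq less_Suc_eq_le)
  next
    case (Suc k)
    have "(T ^^ k) f \<in> coord_space 2" unfolding Suc.IH by (simp add: coord_space_def)
    from T[OF this] show ?case by (simp add: Suc.IH fun_eq_iff mult_ac)
  qed
  from this[of m] show "((\<lambda>v. matrix_op 2 [[0, 1], [1, 0]] (matrix_op 2 [[0, z], [inverse z, 0]] v)) ^^ m) f = f"
    using f assms unfolding T_def
    by (auto simp: coord_space_def fun_eq_iff numeral_2_eq_2 not_less_eq_eq less_Suc_eq_le power_inverse)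
qed

text \<open>A common eigenvector of all reflections spans an invariant line, which is irreducible
  for reasons of dimension; its eigenvalues at 1 and 2 determine the character.\<close>

lemma irreducible_block_char_rep:
  assumes u: "u \<in> zn_space n" "u \<noteq> 0" and refl: "\<And>t. \<exists>c. reflect n t u = c *\<^sub>C u"
    and a: "reflect n 1 u = a *\<^sub>C u" "a\<^sup>2 = 1" and b: "reflect n 2 u = b *\<^sub>C u" "b\<^sup>2 = 1"
    and ab: "(a * b) ^ dihedral_index n = 1"
  shows "irreducible_block n (char_rep (dihedral_index n) a b) [u]"
  unfolding irreducible_block_def
proof (intro conjI allI impI ballI)
  have lc: "lin_comb [u] f = f 0 *\<^sub>C u" for f
    by (simp add: lin_comb_def)
  have span: "complex_vector.span (set [u]) = range (\<lambda>c. c *\<^sub>C u)"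
    by (simp add: complex_vector.span_singleton)
  show "\<exists>A B. dihedral_action (dihedral_index n) (coord_space (length [u])) A B \<and>
      char_rep (dihedral_index n) a b = \<lparr>rspace = coord_space (length [u]),
        raction = induced_hom (GL (coord_space (length [u]))) (gen_map A B)\<rparr> \<and>
      (\<forall>f\<in>coord_space (length [u]). lin_comb [u] (A f) = reflect n 1 (lin_comb [u] f) \<and>
         lin_comb [u] (B f) = reflect n 2 (lin_comb [u] f))"
  proof (intro exI conjI ballI)
    show "dihedral_action (dihedral_index n) (coord_space (length [u]))
        (matrix_op 1 [[a]]) (matrix_op 1 [[b]])"
      using dihedral_action_char_rep[OF a(2) b(2) ab] by simp
    show "char_rep (dihedral_index n) a b = \<lparr>rspace = coord_space (length [u]),
        raction = induced_hom (GL (coord_space (length [u])))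
          (gen_map (matrix_op 1 [[a]]) (matrix_op 1 [[b]]))\<rparr>"
      by (simp add: char_rep_def)
    fix f assume "f \<in> coord_space (length [u])"
    then have f: "f \<in> coord_space 1" by simp
    show "lin_comb [u] (matrix_op 1 [[a]] f) = reflect n 1 (lin_comb [u] f)"
      "lin_comb [u] (matrix_op 1 [[b]] f) = reflect n 2 (lin_comb [u] f)"
      unfolding matrix_op_1[OF f] lc reflect_scale a(1) b(1) by (simp_all add: mult.commute)
  qed
  show "set [u] \<subseteq> zn_space n" using u by simp
  show "reflect n t f \<in> complex_vector.span (set [u])" if "f \<in> complex_vector.span (set [u])" for t f
  proof -
    obtain c where "reflect n t u = c *\<^sub>C u" using refl by blast
    then show ?thesis using that unfolding span by (auto simp: reflect_scale scaleC_scaleC)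
  qed
  show "complex_vector.span (set [u]) \<noteq> {0}"
    using u(2) complex_vector.span_base[of u "set [u]"] by auto
  fix W assume "complex_vector.subspace W \<and> W \<subseteq> complex_vector.span (set [u]) \<and>
    (\<forall>t. \<forall>f\<in>W. reflect n t f \<in> W)"
  then have W: "complex_vector.subspace W" "W \<subseteq> complex_vector.span (set [u])" by auto
  show "W = {0} \<or> W = complex_vector.span (set [u])"
  proof (cases "W \<subseteq> {0}")
    case True
    then show ?thesis using complex_vector.subspace_0[OF W(1)] by auto
  next
    case False
    then obtain f where "f \<in> W" "f \<noteq> 0" by auto
    moreover from this W(2) obtain c where "f = c *\<^sub>C u" unfolding span by auto
    ultimately have "c *\<^sub>C u \<in> W" "c \<noteq> 0" by auto
    then have "inverse c *\<^sub>C c *\<^sub>C u \<in> W" using complex_vector.subspace_scale[OF W(1)] by blast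
    then have "u \<in> W" using \<open>c \<noteq> 0\<close> by (simp add: scaleC_scaleC scaleC_one)
    then have "complex_vector.span (set [u]) \<subseteq> W" by (intro complex_vector.span_minimal W(1)) simp
    then show ?thesis using W(2) by blast
  qed
qed

lemma span_pair:
  assumes "x \<in> complex_vector.span {p, q}"
  obtains a b where "x = a *\<^sub>C p + b *\<^sub>C q"
proof -
  from assms obtain a where "x - a *\<^sub>C p \<in> complex_vector.span {q}"
    by (auto simp: complex_vector.span_insert)
  then obtain b where "x - a *\<^sub>C p = b *\<^sub>C q" by (auto simp: complex_vector.span_singleton)
  then show thesis by (intro that[of a b]) (simp add: algebra_simps)
qed

lemma mode_nonzero: "n > 0 \<Longrightarrow> mode n j \<noteq> 0"
proof
  assume "n > 0" "mode n j = 0"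
  then have "mode n j 1 = 0" by simp
  with \<open>n > 0\<close> show False by (simp add: mode_def)
qed

text \<open>
  The product of two reflections acts on the line of each mode by a scalar; the two scalars differ
  exactly when \<open>n\<close> does not divide \<open>4 * j\<close>, so that an invariant subspace splits along the modes.
\<close>

lemma invariant_subspace_modes:
  assumes n: "n > 0" and j: "\<not> int n dvd 4 * j"
    and W: "complex_vector.subspace W" "W \<subseteq> complex_vector.span {mode n j, mode n (- j)}"
      "\<And>t f. f \<in> W \<Longrightarrow> reflect n t f \<in> W"
  shows "W = {0} \<or> W = complex_vector.span {mode n j, mode n (- j)}"
proof (cases "W \<subseteq> {0}")
  case True
  then show ?thesis using complex_vector.subspace_0[OF W(1)] by auto
next
  case False
  let ?p = "mode n j" and ?q = "mode n (- j)"
  define z where "z = \<omega> n powi (2 * j)"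
  have z: "z \<noteq> 0" "inverse z = \<omega> n powi (- 2 * j)" by (simp_all add: z_def flip: power_int_minus)
  \<comment> \<open>Equality of \<open>z\<close> and its inverse would make the power of \<omega>
    with exponent 4j equal to 1, so \<open>n\<close> would divide 4j.\<close>
  have zz: "z - inverse z \<noteq> 0"
  proof
    assume "z - inverse z = 0"
    then have "\<omega> n powi (2 * j) = \<omega> n powi (- 2 * j)" unfolding z(2)[symmetric] by (simp add: z_def)
    then show False using j by (simp add: omega_powi_eq_iff[OF n] mod_eq_dvd_iff)
  qed
  have swap: "reflect n 1 ?p = z *\<^sub>C ?q" "reflect n 1 ?q = inverse z *\<^sub>C ?p"
    unfolding z by (simp_all add: reflect_mode[OF n] z_def)
  have rot: "reflect n 2 (reflect n 1 ?p) = inverse z *\<^sub>C ?p" "reflect n 2 (reflect n 1 ?q) = z *\<^sub>C ?q"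
  proof -
    have "\<omega> n powi (2 * j) * \<omega> n powi (- 4 * j) = \<omega> n powi (- 2 * j)"
      "\<omega> n powi (- 2 * j) * \<omega> n powi (4 * j) = \<omega> n powi (2 * j)"
      by (simp_all flip: power_int_add)
    then show "reflect n 2 (reflect n 1 ?p) = inverse z *\<^sub>C ?p" "reflect n 2 (reflect n 1 ?q) = z *\<^sub>C ?q"
      unfolding swap reflect_scale reflect_mode[OF n] scaleC_scaleC z(2) by (simp_all add: z_def)
  qed
  obtain f where f: "f \<in> W" "f \<noteq> 0" using False by auto
  then obtain a b where ab: "f = a *\<^sub>C ?p + b *\<^sub>C ?q" using W(2) span_pair by blast
  define g where "g = reflect n 2 (reflect n 1 f)"
  have "g \<in> W" unfolding g_def using f W(3) by blast
  have g: "g = a *\<^sub>C inverse z *\<^sub>C ?p + b *\<^sub>C z *\<^sub>C ?q"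
    by (simp only: g_def ab reflect_add reflect_scale rot)
  have mem: "h \<in> W" if "c *\<^sub>C h \<in> W" "c \<noteq> 0" for c h
    using complex_vector.subspace_scale[OF W(1) that(1), of "inverse c"] that(2)
    by (simp add: scaleC_scaleC scaleC_one)
  have "?p \<in> W \<or> ?q \<in> W"
  proof (cases "a = 0")
    case True
    then have "b *\<^sub>C ?q \<in> W" "b \<noteq> 0" using f ab by auto
    then show ?thesis using mem by blast
  next
    case False
    \<comment> \<open>In \<open>g\<close> the second mode has been scaled by \<open>z\<close>, so
      this difference eliminates it and leaves a multiple of the first mode.\<close>
    have "z *\<^sub>C f - g \<in> W"
      using f(1) \<open>g \<in> W\<close> by (intro complex_vector.subspace_diff complex_vector.subspace_scale W(1))
    also have "z *\<^sub>C f - g = (a * (z - inverse z)) *\<^sub>C ?p"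
      by (simp add: g ab fun_eq_iff algebra_simps)
    finally have "?p \<in> W" by (rule mem) (use False zz in simp)
    then show ?thesis ..
  qed
  \<comment> \<open>The reflection at 1 exchanges the two lines up to a nonzero scalar, so one mode
    brings in the other.\<close>
  then have "?p \<in> W \<and> ?q \<in> W"
  proof
    assume "?p \<in> W"
    from W(3)[OF this, of 1] show ?thesis using \<open>?p \<in> W\<close> mem z(1) unfolding swap by blast
  next
    assume "?q \<in> W"
    from W(3)[OF this, of 1] show ?thesis using \<open>?q \<in> W\<close> mem z(1) unfolding swap
      by (meson nonzero_imp_inverse_nonzero)
  qed
  then have "complex_vector.span {?p, ?q} \<subseteq> W" by (intro complex_vector.span_minimal W(1)) auto
  then show ?thesis using W(2) by blast
qed

text \<open>The factor on the second vector is forced by \<alpha> being the plain swap: the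
  reflection at 1 sends the first mode exactly there. The reflection at 2 then sends the first
  vector to \<open>\<omega> n powi (2 * j)\<close> times the second. This scalar is the lower left
  entry, the inverse of the parameter, which explains the minus sign in \<open>s\<close>.\<close>

lemma irreducible_block_W_rep:
  assumes n: "n > 0" and j: "\<not> int n dvd 4 * j"
    and s: "\<omega> (dihedral_index n) powi s = \<omega> n powi (- 2 * j)"
  shows "irreducible_block n (W_rep (dihedral_index n) s) [mode n j, \<omega> n powi (2 * j) *\<^sub>C mode n (- j)]"
    (is "irreducible_block n ?A ?us")
  unfolding irreducible_block_def
proof (intro conjI allI impI ballI)
  let ?m = "dihedral_index n"
  let ?p = "mode n j" and ?q = "mode n (- j)"
  define z where "z = \<omega> n powi (2 * j)"
  have z: "z \<noteq> 0" by (simp add: z_def)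
  have s': "\<omega> ?m powi s = inverse z" "\<omega> ?m powi (- s) = inverse (inverse z)"
    using s by (simp_all add: z_def power_int_minus)
  have m: "?m > 0" using n by (auto simp: dihedral_index_def elim!: evenE)
  have "inverse z ^ ?m = \<omega> ?m powi (s * int ?m)"
    by (simp add: power_int_mult flip: s')
  also have "\<dots> = 1" by (simp add: omega_powi_eq_1_iff[OF m])
  finally have act: "dihedral_action ?m (coord_space 2) (matrix_op 2 [[0, 1], [1, 0]])
      (matrix_op 2 [[0, inverse z], [inverse (inverse z), 0]])"
    using z by (intro dihedral_action_W_rep) auto
  have lc: "lin_comb ?us f = f 0 *\<^sub>C ?p + (f 1 * z) *\<^sub>C ?q" for f
    by (simp add: lin_comb_def z_def scaleC_scaleC numeral_2_eq_2)
  have "\<omega> n powi (2 * 1 * - j) = inverse z" "\<omega> n powi (2 * 2 * j) = z * z" 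
    "\<omega> n powi (2 * 2 * - j) = inverse z * inverse z"
    by (simp_all add: z_def flip: power_int_add power_int_minus)
  then have refl: "reflect n 1 ?p = z *\<^sub>C ?q" "reflect n 1 ?q = inverse z *\<^sub>C ?p"
    "reflect n 2 ?p = (z * z) *\<^sub>C ?q" "reflect n 2 ?q = (inverse z * inverse z) *\<^sub>C ?p"
    unfolding reflect_mode[OF n] by (simp_all add: z_def)
  show "\<exists>A B. dihedral_action ?m (coord_space (length ?us)) A B \<and>
      ?A = \<lparr>rspace = coord_space (length ?us),
        raction = induced_hom (GL (coord_space (length ?us))) (gen_map A B)\<rparr> \<and>
      (\<forall>f\<in>coord_space (length ?us). lin_comb ?us (A f) = reflect n 1 (lin_comb ?us f) \<and>
         lin_comb ?us (B f) = reflect n 2 (lin_comb ?us f))"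
  proof (intro exI conjI ballI)
    show "dihedral_action ?m (coord_space (length ?us)) (matrix_op 2 [[0, 1], [1, 0]])
      (matrix_op 2 [[0, inverse z], [inverse (inverse z), 0]])"
      using act by (simp add: numeral_2_eq_2)
    show "?A = \<lparr>rspace = coord_space (length ?us), raction = induced_hom (GL (coord_space (length ?us)))
      (gen_map (matrix_op 2 [[0, 1], [1, 0]]) (matrix_op 2 [[0, inverse z], [inverse (inverse z), 0]]))\<rparr>"
      by (simp add: W_rep_def s' numeral_2_eq_2)
    fix f assume "f \<in> coord_space (length ?us)"
    then have f: "f \<in> coord_space 2" by (simp add: numeral_2_eq_2)
    show "lin_comb ?us (matrix_op 2 [[0, 1], [1, 0]] f) = reflect n 1 (lin_comb ?us f)"
      unfolding lc matrix_op_antidiagonal[OF f] reflect_add reflect_scale refl scaleC_scaleC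
      using z by (simp add: add.commute mult_ac)
    show "lin_comb ?us (matrix_op 2 [[0, inverse z], [inverse (inverse z), 0]] f) = reflect n 2 (lin_comb ?us f)"
      unfolding lc matrix_op_antidiagonal[OF f] reflect_add reflect_scale refl scaleC_scaleC
      using z by (simp add: add.commute mult_ac)
  qed
  have "z *\<^sub>C ?q \<in> complex_vector.span {?p, ?q}" "?p \<in> complex_vector.span {?p, ?q}"
    by (auto intro: complex_vector.span_scale complex_vector.span_base)
  moreover have "?p \<in> complex_vector.span {?p, z *\<^sub>C ?q}"
    by (rule complex_vector.span_base) simp
  moreover have "inverse z *\<^sub>C z *\<^sub>C ?q \<in> complex_vector.span {?p, z *\<^sub>C ?q}"
    by (rule complex_vector.span_scale, rule complex_vector.span_base) simp
  ultimately have span: "complex_vector.span (set ?us) = complex_vector.span {?p, ?q}"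
    using z unfolding complex_vector.span_eq by (simp add: scaleC_scaleC scaleC_one flip: z_def)
  show "set ?us \<subseteq> zn_space n"
    using mode_in_zn_space complex_vector.subspace_scale[OF subspace_zn_space] by auto
  show "reflect n t f \<in> complex_vector.span (set ?us)" if "f \<in> complex_vector.span (set ?us)" for t f
  proof -
    obtain a b where "f = a *\<^sub>C ?p + b *\<^sub>C ?q" using \<open>f \<in> _\<close> unfolding span by (rule span_pair)
    then show ?thesis unfolding span
      by (auto simp: reflect_add reflect_scale reflect_mode[OF n]
          intro!: complex_vector.span_add complex_vector.span_scale intro: complex_vector.span_base)
  qed
  show "complex_vector.span (set ?us) \<noteq> {0}"
    using mode_nonzero[OF n, of j] complex_vector.span_base[of ?p "set ?us"] by auto
  fix W assume "complex_vector.subspace W \<and> W \<subseteq> complex_vector.span (set ?us) \<and>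
    (\<forall>t. \<forall>f\<in>W. reflect n t f \<in> W)"
  then show "W = {0} \<or> W = complex_vector.span (set ?us)"
    unfolding span by (intro invariant_subspace_modes[OF n j]) auto
qed


subsection \<open>The three decompositions\<close>

lemma omega_powi_double:
  assumes "m > 0"
  shows "\<omega> (2 * m) powi (2 * s) = \<omega> m powi s"
proof -
  have "\<omega> (2 * m) powi 2 = \<omega> m"
    by (simp add: omega_power) (simp add: omega_eq_cis)
  then show ?thesis by (simp add: power_int_mult)
qed

lemma mode_minus_eq:
  assumes "n > 0" "int n dvd 2 * j"
  shows "mode n (- j) = mode n j"
  using assms by (intro mode_cong) (simp_all add: mod_eq_dvd_iff algebra_simps flip: dvd_minus_iff[of _ "2 * j"])

text \<open>Here -j and j agree modulo \<open>n\<close> and the factor in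
  \<open>reflect_mode\<close> is 1, so every reflection fixes the mode.\<close>

lemma irreducible_block_trivial:
  assumes n: "n > 0" and j: "int n dvd 2 * j"
  shows "irreducible_block n (char_rep (dihedral_index n) 1 1) [mode n j]"
proof -
  have "\<omega> n powi (2 * t * j) = 1" for t
    using j dvd_mult[OF j, of t] by (simp add: omega_powi_eq_1_iff[OF n] mult_ac)
  then have refl: "reflect n t (mode n j) = 1 *\<^sub>C mode n j" for t
    by (simp only: reflect_mode[OF n] mode_minus_eq[OF n j])
  show ?thesis
    by (rule irreducible_block_char_rep[OF mode_in_zn_space mode_nonzero[OF n] _ refl _ refl])
      (use refl in blast, simp_all)
qed

text \<open>The indices k and -k differ modulo 4k, but twice them agree. The reflection at t
  therefore exchanges the two modes with one common sign, -1 at t = 1 and 1 at t = 2, and their sum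
  and difference are eigenvectors.\<close>

lemma irreducible_block_sign:
  assumes k: "k > 0" and e: "e = 1 \<or> e = - 1"
  shows "irreducible_block (4 * k) (char_rep (2 * k) (- e) e)
    [mode (4 * k) (int k) + e *\<^sub>C mode (4 * k) (- int k)]"
proof -
  let ?n = "4 * k" and ?p = "mode (4 * k) (int k)" and ?q = "mode (4 * k) (- int k)"
  have n: "?n > 0" using k by simp
  have half: "\<omega> ?n powi (2 * int k) = - 1"
  proof -
    have "\<omega> ?n powi int (2 * k) = - 1"
      using k unfolding power_int_of_nat omega_power by simp
    then show ?thesis by simp
  qed
  define d where "d t = \<omega> ?n powi (2 * t * int k)" for t :: int
  have d: "d 1 = - 1" "d 2 = 1"
    using half by (simp_all add: d_def omega_powi_eq_1_iff[OF n])
  have d': "\<omega> ?n powi (2 * t * (- int k)) = d t" for t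
  proof -
    have "2 * t * (- int k) - 2 * t * int k = int ?n * (- t)" by simp
    then have "int ?n dvd 2 * t * (- int k) - 2 * t * int k" by (metis dvd_triv_left)
    then show ?thesis unfolding d_def omega_powi_eq_iff[OF n] mod_eq_dvd_iff .
  qed
  have refl: "reflect ?n t (?p + e *\<^sub>C ?q) = (d t * e) *\<^sub>C (?p + e *\<^sub>C ?q)" for t
  proof -
    have "reflect ?n t (?p + e *\<^sub>C ?q) = d t *\<^sub>C ?q + e *\<^sub>C d t *\<^sub>C ?p"
      unfolding reflect_add reflect_scale reflect_mode[OF n] d' by (simp add: d_def)
    also have "\<dots> = (d t * e) *\<^sub>C (?p + e *\<^sub>C ?q)"
      using e by (auto simp: fun_eq_iff algebra_simps)
    finally show ?thesis .
  qed
  have nonzero: "?p + e *\<^sub>C ?q \<noteq> 0"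
  proof
    assume eq: "?p + e *\<^sub>C ?q = 0"
    have vals: "\<omega> ?n powi (int k * y) + e * \<omega> ?n powi (- int k * y) = 0" if "y \<in> {1..int ?n}" for y
      using fun_cong[OF eq, of y] that by (simp add: mode_def)
    show False
    \<comment> \<open>At y = 1 the sum of the two modes is \<i> - \<i> = 0, so for e = 1 the test
      point is y = 2, where it is -2. For e = -1 the point y = 1 works.\<close>
    proof (cases "e = 1")
      case True
      have "\<omega> ?n powi (- int k * 2) = - 1"
        using d' d(1) by (metis mult.commute mult_1_right)
      then show False using vals[of 2] half True k by (simp add: mult.commute)
    next
      case False
      then have "\<omega> ?n powi (int k) = \<omega> ?n powi (- int k)" using vals[of 1] e k by simp
      then have "int ?n dvd 2 * int k" unfolding omega_powi_eq_iff[OF n] mod_eq_dvd_iff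
        by (simp only: mult_2 diff_minus_eq_add)
      then show False using k by (auto dest: zdvd_imp_le)
    qed
  qed
  have idx: "dihedral_index ?n = 2 * k" by (simp add: dihedral_index_def)
  have "e\<^sup>2 = 1" "(- e * e) ^ (2 * k) = 1" using e by auto
  moreover have "?p + e *\<^sub>C ?q \<in> zn_space ?n"
    by (intro complex_vector.subspace_add complex_vector.subspace_scale subspace_zn_space mode_in_zn_space)
  ultimately show ?thesis
    using irreducible_block_char_rep[of "?p + e *\<^sub>C ?q" ?n "- e" e] nonzero refl refl[of 1] refl[of 2]
    by (auto simp: d idx)
qed

lemma length_concat_snd_concat_map:
  assumes "\<And>s. length (concat (map snd (f s))) = c"
  shows "length (concat (map snd (concat (map f xs)))) = c * length xs"
  using assms by (induction xs) auto

definition mode_pair :: "nat \<Rightarrow> int \<Rightarrow> (int \<Rightarrow> complex) list" where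
  "mode_pair n j = [mode n j, \<omega> n powi (2 * j) *\<^sub>C mode n (- j)]"

lemma length_mode_pair [simp]: "length (mode_pair n j) = 2"
  by (simp add: mode_pair_def)

lemma modes_in_span:
  assumes "set (mode_pair n j) \<subseteq> S"
  shows "mode n j \<in> complex_vector.span S \<and> mode n (- j) \<in> complex_vector.span S"
proof -
  have "inverse (\<omega> n powi (2 * j)) *\<^sub>C \<omega> n powi (2 * j) *\<^sub>C mode n (- j) \<in> complex_vector.span S"
    using assms by (intro complex_vector.span_scale complex_vector.span_base) (simp add: mode_pair_def)
  then show ?thesis using assms by (simp add: complex_vector.span_base mode_pair_def)
qed

text \<open>For each s the indices -s and 2k - s differ by n/2 and so give the same parameter. The
  first accounts for the modes of absolute index below k, the second for those strictly between k
  and 2k; the one-dimensional blocks take 0, 2k and the pair k, -k.\<close>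

lemma decomposition_4k:
  assumes k: "k > 0"
  shows "irreducible_decomposition (4 * k)
    (replicate 2 (char_rep (2 * k) 1 1) @ [char_rep (2 * k) 1 (-1), char_rep (2 * k) (-1) 1] @
      concat (map (\<lambda>s. replicate 2 (W_rep (2 * k) s)) [1..int k - 1]))"
proof -
  let ?n = "4 * k"
  define u where "u e = mode ?n (int k) + e *\<^sub>C mode ?n (- int k)" for e
  define bs where "bs = [(char_rep (2 * k) 1 1, [mode ?n 0]), (char_rep (2 * k) 1 1, [mode ?n (2 * int k)]),
      (char_rep (2 * k) 1 (-1), [u (-1)]), (char_rep (2 * k) (-1) 1, [u 1])] @
    concat (map (\<lambda>s. [(W_rep (2 * k) s, mode_pair ?n (- s)), (W_rep (2 * k) s, mode_pair ?n (2 * int k - s))])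
      [1..int k - 1])"
  define S where "S = set (concat (map snd bs))"
  have n: "?n > 0" using k by simp
  have idx: "dihedral_index ?n = 2 * k" by (simp add: dihedral_index_def)
  have char: "irreducible_block ?n (char_rep (2 * k) 1 1) [mode ?n j]" if "int ?n dvd 2 * j" for j
    using irreducible_block_trivial[OF n that] by (simp add: idx)
  have W: "irreducible_block ?n (W_rep (2 * k) s) (mode_pair ?n j)"
    if "0 < s" "s < int k" "j = - s \<or> j = 2 * int k - s" for s j
  proof -
    \<comment> \<open>Both choices of \<open>j\<close> are congruent to -s modulo k, and the
      irreducibility condition is that k does not divide \<open>j\<close>.\<close>
    have "\<not> int k dvd s" using that zdvd_not_zless by blast
    then have "\<not> int k dvd j" using that(3) by (auto simp: dvd_diff_right_iff)
    then have "\<not> int ?n dvd 4 * j" by simp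
    moreover have "\<omega> (2 * k) powi s = \<omega> ?n powi (- 2 * j)"
    proof -
      have "\<omega> (2 * k) powi s = \<omega> ?n powi (2 * s)"
        using omega_powi_double[of "2 * k" s] k by simp
      also have "\<dots> = \<omega> ?n powi (- 2 * j)"
        unfolding omega_powi_eq_iff[OF n] using that(3) by (auto simp: mod_eq_dvd_iff)
      finally show ?thesis .
    qed
    ultimately show ?thesis using irreducible_block_W_rep[OF n, of j s, folded mode_pair_def, unfolded idx] by blast
  qed
  have "irreducible_block ?n A us" if "(A, us) \<in> set bs" for A us
    using that char[of 0] char[of "2 * int k"] irreducible_block_sign[OF k, of 1]
      irreducible_block_sign[OF k, of "- 1"] W
    unfolding bs_def u_def by auto
  \<comment> \<open>Four lines, and two planes for each of the k - 1 values of s: 4 + 4(k -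
    1).\<close>
  moreover have "length (concat (map snd bs)) = ?n"
    using k unfolding bs_def map_append concat_append length_append
    by (subst length_concat_snd_concat_map[where c = 4]) (auto simp: nat_diff_distrib)
  moreover have "mode ?n j \<in> complex_vector.span S \<and> mode ?n (- j) \<in> complex_vector.span S"
    if j: "0 \<le> j" "2 * j \<le> int ?n" for j
  proof -
    have pair: "set (mode_pair ?n (- s)) \<subseteq> S" "set (mode_pair ?n (2 * int k - s)) \<subseteq> S"
      if "0 < s" "s < int k" for s
      using that unfolding S_def bs_def by fastforce+
    have base: "mode ?n 0 \<in> S" "mode ?n (2 * int k) \<in> S" "u 1 \<in> S" "u (- 1) \<in> S"
      by (simp_all add: S_def bs_def)
    consider "j = 0" | "0 < j" "j < int k" | "j = int k" | "int k < j" "j < 2 * int k" | "j = 2 * int k"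
      using j by fastforce
    then show ?thesis
    proof cases
      case 1
      then show ?thesis using base by (simp add: complex_vector.span_base)
    next
      case 2
      then show ?thesis using modes_in_span[OF pair(1)[of j]] by simp
    next
      case 3
      \<comment> \<open>The two modes are recovered as half the sum and half the difference of the
        sign vectors.\<close>
      have "(1 / 2) *\<^sub>C (u 1 + u (- 1)) \<in> complex_vector.span S"
        "(1 / 2) *\<^sub>C (u 1 - u (- 1)) \<in> complex_vector.span S"
        using base by (auto intro!: complex_vector.span_scale complex_vector.span_add
            complex_vector.span_diff intro: complex_vector.span_base)
      moreover have "(1 / 2) *\<^sub>C (u 1 + u (- 1)) = mode ?n j" "(1 / 2) *\<^sub>C (u 1 - u (- 1)) = mode ?n (- j)"
        by (simp_all add: u_def fun_eq_iff 3)
      ultimately show ?thesis by metis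
    next
      case 4
      then show ?thesis using modes_in_span[OF pair(2)[of "2 * int k - j"]] by simp
    next
      case 5
      then show ?thesis using base mode_minus_eq[OF n, of j] by (simp add: complex_vector.span_base)
    qed
  qed
  ultimately have "irreducible_decomposition ?n (map fst bs)"
    unfolding S_def by (intro irreducible_decompositionI[OF n]) auto
  moreover have "map fst bs = replicate 2 (char_rep (2 * k) 1 1) @
      [char_rep (2 * k) 1 (-1), char_rep (2 * k) (-1) 1] @
      concat (map (\<lambda>s. replicate 2 (W_rep (2 * k) s)) [1..int k - 1])"
    by (simp add: bs_def map_concat comp_def numeral_2_eq_2)
  ultimately show ?thesis by simp
qed

text \<open>Again two planes, of indices -s and m - s, share each parameter. Since
  \<open>m = 2 * k + 1\<close> is odd, \<open>n\<close> divides 4j only if it divides 2j, so no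
  plane degenerates into sign characters. The count is 2 + 4k.\<close>

lemma decomposition_4k_plus_2:
  "irreducible_decomposition (4 * k + 2)
    (replicate 2 (char_rep (2 * k + 1) 1 1) @
      concat (map (\<lambda>s. replicate 2 (W_rep (2 * k + 1) s)) [1..int k]))"
proof -
  let ?n = "4 * k + 2"
  define m where "m = 2 * k + 1"
  define bs where "bs = [(char_rep m 1 1, [mode ?n 0]), (char_rep m 1 1, [mode ?n (int m)])] @
    concat (map (\<lambda>s. [(W_rep m s, mode_pair ?n (- s)), (W_rep m s, mode_pair ?n (int m - s))]) [1..int k])"
  define S where "S = set (concat (map snd bs))"
  have n: "?n > 0" "?n = 2 * m" by (simp_all add: m_def)
  have idx: "dihedral_index ?n = m" by (simp add: dihedral_index_def m_def)
  have char: "irreducible_block ?n (char_rep m 1 1) [mode ?n j]" if "int ?n dvd 2 * j" for j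
    using irreducible_block_trivial[OF n(1) that] unfolding idx .
  have W: "irreducible_block ?n (W_rep m s) (mode_pair ?n j)"
    if "0 < s" "s \<le> int k" "j = - s \<or> j = int m - s" for s j
  proof -
    have "\<not> int m dvd s" using that zdvd_not_zless[of s "int m"] by (simp add: m_def)
    then have "\<not> int m dvd j" using that(3) by (auto simp: dvd_diff_right_iff)
    \<comment> \<open>Oddness of \<open>m\<close> cancels one factor 2 from the condition that 2m
      divides 4j.\<close>
    moreover have "coprime (int m) 2" by (simp add: m_def)
    ultimately have "\<not> int m dvd 2 * j" by (simp add: coprime_dvd_mult_right_iff)
    then have "\<not> 2 * int m dvd 2 * (2 * j)" unfolding dvd_mult_cancel_left by simp
    moreover have "2 * int m = int ?n" "2 * (2 * j) = 4 * j" by (simp_all add: m_def)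
    ultimately have "\<not> int ?n dvd 4 * j" by metis
    moreover have "\<omega> m powi s = \<omega> ?n powi (- 2 * j)"
    proof -
      have "\<omega> m powi s = \<omega> ?n powi (2 * s)"
        unfolding n(2) by (rule omega_powi_double[symmetric]) (simp add: m_def)
      also have "\<dots> = \<omega> ?n powi (- 2 * j)"
        unfolding omega_powi_eq_iff[OF n(1)] using that(3) by (auto simp: mod_eq_dvd_iff m_def)
      finally show ?thesis .
    qed
    ultimately show ?thesis using irreducible_block_W_rep[OF n(1), of j s, folded mode_pair_def, unfolded idx] by blast
  qed
  have "irreducible_block ?n A us" if "(A, us) \<in> set bs" for A us
  proof -
    have "irreducible_block ?n (char_rep m 1 1) [mode ?n (int m)]"
      by (rule char) (simp add: m_def)
    then show ?thesis using that char[of 0] W unfolding bs_def by auto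
  qed
  moreover have "length (concat (map snd bs)) = ?n"
    unfolding bs_def map_append concat_append length_append
    by (subst length_concat_snd_concat_map[where c = 4]) auto
  moreover have "mode ?n j \<in> complex_vector.span S \<and> mode ?n (- j) \<in> complex_vector.span S"
    if j: "0 \<le> j" "2 * j \<le> int ?n" for j
  proof -
    have pair: "set (mode_pair ?n (- s)) \<subseteq> S" "set (mode_pair ?n (int m - s)) \<subseteq> S"
      if "0 < s" "s \<le> int k" for s
      using that unfolding S_def bs_def by fastforce+
    have base: "mode ?n 0 \<in> S" "mode ?n (int m) \<in> S"
      by (simp_all add: S_def bs_def)
    consider "j = 0" | "0 < j" "j \<le> int k" | "int k < j" "j < int m" | "j = int m"
      using j unfolding m_def by fastforce
    then show ?thesis
    proof cases
      case 1
      then show ?thesis using base by (simp add: complex_vector.span_base)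
    next
      case 2
      then show ?thesis using modes_in_span[OF pair(1)[of j]] by simp
    next
      case 3
      then show ?thesis using modes_in_span[OF pair(2)[of "int m - j"]] by (simp add: m_def)
    next
      case 4
      have "mode ?n (- int m) = mode ?n (int m)"
        by (rule mode_minus_eq[OF n(1)]) (simp add: m_def)
      then show ?thesis using base 4 by (simp add: complex_vector.span_base)
    qed
  qed
  ultimately have "irreducible_decomposition ?n (map fst bs)"
    unfolding S_def by (intro irreducible_decompositionI[OF n(1)]) auto
  moreover have "map fst bs = replicate 2 (char_rep m 1 1) @
      concat (map (\<lambda>s. replicate 2 (W_rep m s)) [1..int k])"
    by (simp add: bs_def map_concat comp_def numeral_2_eq_2)
  ultimately show ?thesis by (simp add: m_def)
qed

text \<open>The dihedral index is now \<open>n\<close> itself, so the plane of index -s has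
  parameter exponent 2s without any change of root of unity. One plane for each s and the constant
  mode give 1 + 2r.\<close>

lemma decomposition_odd:
  "irreducible_decomposition (2 * r + 1)
    (char_rep (2 * r + 1) 1 1 # map (\<lambda>s. W_rep (2 * r + 1) (2 * s)) [1..int r])"
proof -
  define n where "n = 2 * r + 1"
  define bs where "bs = (char_rep n 1 1, [mode n 0]) # map (\<lambda>s. (W_rep n (2 * s), mode_pair n (- s))) [1..int r]"
  define S where "S = set (concat (map snd bs))"
  have n: "n > 0" by (simp add: n_def)
  have idx: "dihedral_index n = n" by (simp add: dihedral_index_def n_def)
  have W: "irreducible_block n (W_rep n (2 * s)) (mode_pair n (- s))" if "0 < s" "s \<le> int r" for s
  proof -
    have "\<not> int n dvd s" using that zdvd_not_zless[of s "int n"] by (simp add: n_def)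
    moreover have "coprime (int n) 4"
      using coprime_power_right_iff[of "int n" 2 2] by (simp add: n_def)
    ultimately have "\<not> int n dvd 4 * - s" by (simp add: coprime_dvd_mult_right_iff)
    then show ?thesis using irreducible_block_W_rep[OF n, of "- s" "2 * s", folded mode_pair_def, unfolded idx] by simp
  qed
  have "irreducible_block n A us" if "(A, us) \<in> set bs" for A us
    using that irreducible_block_trivial[OF n, of 0] W unfolding bs_def by (auto simp: idx)
  moreover have "length (concat (map snd bs)) = n"
    by (simp add: bs_def length_concat comp_def sum_list_triv n_def)
  moreover have "mode n j \<in> complex_vector.span S \<and> mode n (- j) \<in> complex_vector.span S"
    if j: "0 \<le> j" "2 * j \<le> int n" for j
  proof (cases "j = 0")
    case True
    then show ?thesis by (simp add: complex_vector.span_base S_def bs_def)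
  next
    case False
    then have "set (mode_pair n (- j)) \<subseteq> S"
      using j unfolding S_def bs_def n_def by fastforce
    from modes_in_span[OF this] show ?thesis by simp
  qed
  ultimately have "irreducible_decomposition n (map fst bs)"
    unfolding S_def by (intro irreducible_decompositionI[OF n]) auto
  moreover have "map fst bs = char_rep n 1 1 # map (\<lambda>s. W_rep n (2 * s)) [1..int r]"
    by (simp add: bs_def comp_def)
  ultimately show ?thesis by (simp add: n_def)
qed

theorem theorem5p2:
  fixes n :: nat
  assumes "n > 0"
  shows "(\<forall>k::nat. n = 4 * k \<longrightarrow>
            irreducible_decomposition n
              (replicate 2 (char_rep (2 * k) 1 1) @ [char_rep (2 * k) 1 (-1), char_rep (2 * k) (-1) 1] @
               concat (map (\<lambda>s. replicate 2 (W_rep (2 * k) s)) [1..int k - 1]))) \<and>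
         (\<forall>k::nat. n = 4 * k + 2 \<longrightarrow>
            irreducible_decomposition n
              (replicate 2 (char_rep (2 * k + 1) 1 1) @
               concat (map (\<lambda>s. replicate 2 (W_rep (2 * k + 1) s)) [1..int k]))) \<and>
         (\<forall>r::nat. n = 2 * r + 1 \<longrightarrow>
            irreducible_decomposition n
              (char_rep n 1 1 # map (\<lambda>s. W_rep n (2 * s)) [1..int r]))"
proof (intro conjI allI impI)
  fix k assume "n = 4 * k"
  \<comment> \<open>Positivity of \<open>n\<close> excludes k = 0.\<close>
  with assms show "irreducible_decomposition n
      (replicate 2 (char_rep (2 * k) 1 1) @ [char_rep (2 * k) 1 (-1), char_rep (2 * k) (-1) 1] @
       concat (map (\<lambda>s. replicate 2 (W_rep (2 * k) s)) [1..int k - 1]))"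
    using decomposition_4k[of k] by simp
next
  fix k assume "n = 4 * k + 2"
  then show "irreducible_decomposition n
      (replicate 2 (char_rep (2 * k + 1) 1 1) @
       concat (map (\<lambda>s. replicate 2 (W_rep (2 * k + 1) s)) [1..int k]))"
    using decomposition_4k_plus_2[of k] by simp
next
  fix r assume "n = 2 * r + 1"
  then show "irreducible_decomposition n (char_rep n 1 1 # map (\<lambda>s. W_rep n (2 * s)) [1..int r])"
    using decomposition_odd[of r] by simp
qed

end
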